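(* Let $r \ge 3$ and $\varepsilon > 0$ be constants. There exists $\gamma = \gamma(r) > 0$ such that if $p=p(n) \le n^{-2/r + \gamma}$ (and $r\mid n$), then $$F_r(G(n,p)) \le e^{O^*(\sqrt{n})} \, \Sigma(n,m)$$ with high probability, where $m = \big\lfloor \binom{n}{r}p^{\binom{r}{2}} \big\rfloor$.
   Context: $G(n,p)$ is the binomial random graph on $n$ vertices, and $F_r(G)$ denotes the number of $K_r$-factors in a graph $G$ (partitions of $V(G)$ into $r$-sets each inducing a $K_r$ in $G$). For $r\mid n$, $$\Sigma(n,m) = \frac{n!}{r!^{\,n/r}(n/r)!}\, \frac{(m)_{n/r}}{(N)_{n/r}},\qquad N=\binom{n}{r},$$ where $(x)_k = x(x-1)\cdots(x-k+1)$. $f=O^*(g)$ means that there is a constant $C$ with $f(n)=O(g(n)(\log n)^C)$. "With high probability" means with probability tending to $1$ as $n\to\infty$ (through multiples of $r$). *)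

theory Defs
  imports "HOL-Probability.Probability" "HOL-Library.Landau_Symbols" "HOL-Library.Disjoint_Sets"
begin

text \<open>A simple graph is given by its vertex set \<open>V\<close> and the set \<open>E\<close> of its edges, which are
  two-element subsets of \<open>V\<close>.\<close>

definition all_edges :: "'a set \<Rightarrow> 'a set set" where
  "all_edges V = {e. e \<subseteq> V \<and> card e = 2}"

text \<open>The binomial random graph on the vertex set \<open>{..<n}\<close>, as the distribution of its edge set.\<close>

definition Gnp :: "nat \<Rightarrow> real \<Rightarrow> nat set set pmf" where
  "Gnp n p = map_pmf (\<lambda>c. {e \<in> all_edges {..<n}. c e})
     (Pi_pmf (all_edges {..<n}) False (\<lambda>_. bernoulli_pmf p))"

definition is_clique_factor :: "nat \<Rightarrow> 'a set \<Rightarrow> 'a set set \<Rightarrow> 'a set set \<Rightarrow> bool" where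
  "is_clique_factor r V E P \<longleftrightarrow>
     partition_on V P \<and> (\<forall>A\<in>P. card A = r \<and> all_edges A \<subseteq> E)"

definition num_clique_factors :: "nat \<Rightarrow> 'a set \<Rightarrow> 'a set set \<Rightarrow> nat" where
  "num_clique_factors r V E = card {P. is_clique_factor r V E P}"

definition falling_fact :: "real \<Rightarrow> nat \<Rightarrow> real" where
  "falling_fact x k = (\<Prod>i<k. x - real i)"

text \<open>This is \<open>\<Sigma>(n,m)\<close>; it is meaningful only when \<open>r\<close> divides \<open>n\<close>.\<close>

definition Sigma_factors :: "nat \<Rightarrow> nat \<Rightarrow> nat \<Rightarrow> real" where
  "Sigma_factors r n m =
     fact n / (fact r ^ (n div r) * fact (n div r)) *
     (falling_fact (real m) (n div r) / falling_fact (real (n choose r)) (n div r))"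

definition bigo_star :: "(nat \<Rightarrow> real) \<Rightarrow> (nat \<Rightarrow> real) \<Rightarrow> bool" where
  "bigo_star f g \<longleftrightarrow> (\<exists>C::real. f \<in> O(\<lambda>n. g n * ln (real n) powr C))"

text \<open>The limit is taken through the multiples of \<open>r\<close> only.\<close>

definition whp :: "nat \<Rightarrow> (nat \<Rightarrow> 'b pmf) \<Rightarrow> (nat \<Rightarrow> 'b \<Rightarrow> bool) \<Rightarrow> bool" where
  "whp r D Q \<longleftrightarrow>
     ((\<lambda>n. measure_pmf.prob (D n) {x. Q n x}) \<longlongrightarrow> 1) (inf sequentially (principal {n. r dvd n}))"

end

theory Submission
  imports Defs "HOL-Real_Asymp.Real_Asymp"
begin

text \<open>Write $n = rk$, $q = p^{\binom r2}$, $\mu = \binom nr q$ and $m = \lfloor\mu\rfloor$. If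
  $m < 3k$, the expected number of factors tends to $0$. If $m \ge 3k$, the expectation is too large
  by a factor of about $e^{k^2/2m}$, because it is dominated by graphs with too many copies of $K_r$.
  By Chebyshev's inequality the number $X$ of copies is at most $M = m + O(\sqrt\mu \log n)$ with high
  probability, so it suffices to bound the expected number of factors on the event $X \le M$. A
  factor $P$ contributes there at most $(1-x)^{Y - (M - k)}$ with $x = k/m$, where $Y$ counts the
  copies outside $P$ that are completed by the random edges outside $P$. Janson's inequality bounds
  $E(1-x)^Y$ by $e^{-x\mu + O(\sqrt n)}$, and $(m)_k \ge m^k e^{-k} (1-x)^{-(m-k)}$ turns the result
  into $\Sigma(n,m)$. For $r \ge 4$ it is enough to count in $Y$ the copies that are edge-disjoint
  from $P$; for $r = 3$ the triangles that use one edge of $P$ have to be counted as well.\<close>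

section \<open>Random subsets of a finite set\<close>

text \<open>The value x = k/m minimises -x m - (m-k) ln(1-x), and at this point the bound coincides
  with the Stirling estimate of (m)_k; hence nothing of exponential order is lost. Two errors
  remain. Allowing X up to M = m + t costs (1-x)^(-t), and since x sqrt(\<mu>) is at most sqrt(k),
  this is exp(O(sqrt n log n)). In Janson's inequality the pairs of copies with s common vertices
  cost about (x \<mu>)^2 / (n^s p^(s choose 2)), where x \<mu> is about k. As \<mu> \<ge> k, the
  denominator is at least of order n^(2 - 2/r), with s = 2 and s = r - 1 as the extreme cases. The
  resulting cost n^(2/r) is at most sqrt n exactly when r \<ge> 4, which is why triangles need a
  separate treatment.

  The bound on p from above enters through one estimate, n^(r-s) p^((r choose 2) - (s choose 2))
  \<le> 1 for 2 \<le> s < r, and gamma is chosen for it. It keeps the variance of X of order at most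
  \<mu>, and for r = 3 it reads n p^2 \<le> 1.\<close>

definition random_subset :: "'a set \<Rightarrow> real \<Rightarrow> 'a set pmf" where
  "random_subset E p = map_pmf (\<lambda>c. {e \<in> E. c e}) (Pi_pmf E False (\<lambda>_. bernoulli_pmf p))"

abbreviation rs_exp :: "'a set \<Rightarrow> real \<Rightarrow> ('a set \<Rightarrow> real) \<Rightarrow> real" where
  "rs_exp E p h \<equiv> measure_pmf.expectation (random_subset E p) h"

lemma Gnp_eq_random_subset: "Gnp n p = random_subset (all_edges {..<n}) p"
  by (simp add: Gnp_def random_subset_def)

lemma finite_set_random_subset: "finite E \<Longrightarrow> finite (set_pmf (random_subset E p))"
  by (rule finite_subset[of _ "Pow E"]) (auto simp: random_subset_def)

lemma integrable_random_subset [simp]: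
  fixes h :: "'a set \<Rightarrow> real"
  shows "finite E \<Longrightarrow> integrable (measure_pmf (random_subset E p)) h"
  by (intro integrable_measure_pmf_finite finite_set_random_subset)

lemma rs_exp_mono:
  assumes "finite E" "\<And>R. h R \<le> h' R"
  shows "rs_exp E p h \<le> rs_exp E p h'"
  using assms by (intro integral_mono) auto

lemma random_subset_insert:
  assumes "finite E" "a \<notin> E"
  shows "random_subset (insert a E) p =
    bernoulli_pmf p \<bind> (\<lambda>b. map_pmf (\<lambda>R. if b then insert a R else R) (random_subset E p))"
proof -
  have "{e \<in> insert a E. (f(a := b)) e} = (if b then insert a {e \<in> E. f e} else {e \<in> E. f e})" for f b
    using assms by auto
  thus ?thesis
    unfolding random_subset_def Pi_pmf_insert'[OF assms] map_bind_pmf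
    by (simp add: map_pmf_def bind_assoc_pmf bind_return_pmf)
qed

lemma rs_exp_insert:
  assumes "finite E" "a \<notin> E" "0 \<le> p" "p \<le> 1"
  shows "rs_exp (insert a E) p h = p * rs_exp E p (\<lambda>R. h (insert a R)) + (1 - p) * rs_exp E p h"
  using assms(3,4)
  by (subst random_subset_insert[OF assms(1,2)], subst pmf_expectation_bind[of UNIV])
     (auto simp: UNIV_bool finite_set_random_subset assms(1))

lemma rs_exp_mem:
  assumes "finite E" "a \<in> E" "0 \<le> p" "p \<le> 1"
  shows "rs_exp E p (\<lambda>R. of_bool (a \<in> R) * h R) = p * rs_exp E p (\<lambda>R. h (insert a R))"
proof -
  define E' where "E' = E - {a}"
  have E: "E = insert a E'" "finite E'" "a \<notin> E'" using assms by (auto simp: E'_def)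
  have z: "rs_exp E' p (\<lambda>R. of_bool (a \<in> R) * h R) = rs_exp E' p (\<lambda>R. 0)"
    using E by (intro integral_cong_AE) (auto simp: AE_measure_pmf_iff random_subset_def)
  show ?thesis unfolding E(1) rs_exp_insert[OF E(2,3) assms(3,4)] z
    by (simp add: algebra_simps)
qed

text \<open>By independence, conditioning on A \<subseteq> R amounts to adding A to an unconditioned
  sample. This product form replaces conditional expectations and stays valid for p = 0.\<close>

lemma rs_exp_superset:
  assumes "finite E" "A \<subseteq> E" "0 \<le> p" "p \<le> 1"
  shows "rs_exp E p (\<lambda>R. of_bool (A \<subseteq> R) * h R) = p ^ card A * rs_exp E p (\<lambda>R. h (R \<union> A))"
proof -
  have "finite A" using assms finite_subset by auto
  thus ?thesis using assms(2)
  proof (induction A arbitrary: h rule: finite_induct)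
    case (insert a A)
    have "rs_exp E p (\<lambda>R. of_bool (insert a A \<subseteq> R) * h R) =
          rs_exp E p (\<lambda>R. of_bool (a \<in> R) * (of_bool (A \<subseteq> R) * h R))"
      by (intro Bochner_Integration.integral_cong) auto
    also have "\<dots> = p * rs_exp E p (\<lambda>R. of_bool (A \<subseteq> insert a R) * h (insert a R))"
      using insert assms by (intro rs_exp_mem) auto
    also have "(\<lambda>R. of_bool (A \<subseteq> insert a R) * h (insert a R)) = (\<lambda>R. of_bool (A \<subseteq> R) * h (insert a R))"
      using insert by (auto simp: subset_insert)
    also have "rs_exp E p \<dots> = p ^ card A * rs_exp E p (\<lambda>R. h (insert a (R \<union> A)))"
      using insert.IH[of "\<lambda>R. h (insert a R)"] insert.prems by simp
    finally show ?case using insert by (simp add: algebra_simps)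
  qed auto
qed

lemma rs_exp_superset_prob:
  assumes "finite E" "A \<subseteq> E" "0 \<le> p" "p \<le> 1"
  shows "rs_exp E p (\<lambda>R. of_bool (A \<subseteq> R)) = p ^ card A"
  using rs_exp_superset[OF assms, of "\<lambda>_. 1"] by simp

text \<open>A form of Janson's inequality. One only ever conditions on given elements being
  present, so that the monotonicity of the remaining product replaces the Harris inequality.\<close>

lemma Janson_product:
  assumes E: "finite E" "0 \<le> p" "p \<le> 1" and x: "0 \<le> x" "x \<le> 1"
    and I: "finite I" "\<And>i. i \<in> I \<Longrightarrow> A i \<subseteq> E"
  shows "rs_exp E p (\<lambda>R. \<Prod>i\<in>I. 1 - x * of_bool (A i \<subseteq> R)) \<le>
    exp (- x * (\<Sum>i\<in>I. p ^ card (A i)) +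
         x\<^sup>2 * (\<Sum>i\<in>I. \<Sum>j\<in>{j\<in>I. j \<noteq> i \<and> A i \<inter> A j \<noteq> {}}. p ^ card (A i \<union> A j)))"
  using I
proof (induction I rule: finite_induct)
  case (insert i I)
  \<comment> \<open>Given that A i is present, only the factors with index in J are affected; the
    remaining product \<open>Z (I - J)\<close> is independent of that event.\<close>
  define J where "J = {j\<in>I. A i \<inter> A j \<noteq> {}}"
  define D where "D = (\<Sum>j\<in>J. p ^ card (A i \<union> A j))"
  define Z where "Z = (\<lambda>L R. \<Prod>j\<in>L. 1 - x * of_bool (A j \<subseteq> R))"
  let ?pi = "p ^ card (A i)"
  have fJ: "finite J" "J \<subseteq> I" using insert by (auto simp: J_def)
  have Z01: "0 \<le> Z L R" "Z L R \<le> 1" for L R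
    unfolding Z_def using x by (auto intro!: prod_nonneg prod_le_1)
  have Zsplit: "Z I R = Z J R * Z (I - J) R" for R
    unfolding Z_def prod.subset_diff[OF fJ(2) insert.hyps(1)] by (rule mult.commute)
  \<comment> \<open>Linearising the dependent factors leaves a single additional set A j in each
    term, so that it is enough to plant A i \<union> A j.\<close>
  have bern: "1 - x * (\<Sum>j\<in>J. of_bool (A j \<subseteq> R)) \<le> Z J R" for R
    using fJ(1) unfolding Z_def
  proof (induction J rule: finite_induct)
    case (insert j L)
    have le1: "(\<Prod>j\<in>L. 1 - x * of_bool (A j \<subseteq> R)) \<le> 1" using x by (auto intro!: prod_le_1)
    show ?case using insert mult_left_mono[OF le1 x(1)]
      by (auto simp: algebra_simps)
  qed auto
  have indep: "rs_exp E p (\<lambda>R. of_bool (A i \<subseteq> R) * Z (I - J) R) = ?pi * rs_exp E p (Z (I - J))"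
  proof -
    have "Z (I - J) (R \<union> A i) = Z (I - J) R" for R
      unfolding Z_def by (intro prod.cong) (auto simp: J_def)
    thus ?thesis using rs_exp_superset[of E "A i" p "Z (I - J)"] E insert.prems by simp
  qed
  have decr: "rs_exp E p (\<lambda>R. of_bool (A i \<union> A j \<subseteq> R) * Z (I - J) R)
      \<le> p ^ card (A i \<union> A j) * rs_exp E p (Z (I - J))" if "j \<in> J" for j
  proof -
    have "Z (I - J) (R \<union> B) \<le> Z (I - J) R" for R B
      unfolding Z_def using x by (intro prod_mono) auto
    moreover have "A i \<union> A j \<subseteq> E" using insert.prems that fJ by blast
    ultimately show ?thesis
      using E by (subst rs_exp_superset) (auto intro!: mult_left_mono rs_exp_mono)
  qed
  \<comment> \<open>Replacing \<open>Z I\<close> by the larger \<open>Z (I - J)\<close> on the left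
    requires a nonnegative coefficient. For a negative one the two sides are separated by 0.\<close>
  have key: "(?pi - x * D) * rs_exp E p (Z I) \<le> rs_exp E p (\<lambda>R. of_bool (A i \<subseteq> R) * Z I R)"
  proof (cases "?pi - x * D \<ge> 0")
    case True
    have "(?pi - x * D) * rs_exp E p (Z I) \<le> (?pi - x * D) * rs_exp E p (Z (I - J))"
      using True E Z01 by (intro mult_left_mono rs_exp_mono) (auto simp: Zsplit mult_left_le_one_le)
    also have "\<dots> \<le> rs_exp E p (\<lambda>R. of_bool (A i \<subseteq> R) * Z (I - J) R) -
         x * (\<Sum>j\<in>J. rs_exp E p (\<lambda>R. of_bool (A i \<union> A j \<subseteq> R) * Z (I - J) R))"
    proof -
      have "(\<Sum>j\<in>J. rs_exp E p (\<lambda>R. of_bool (A i \<union> A j \<subseteq> R) * Z (I - J) R)) \<le> D * rs_exp E p (Z (I - J))"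
        unfolding D_def sum_distrib_right by (intro sum_mono decr)
      from mult_left_mono[OF this x(1)] show ?thesis unfolding indep by (simp add: algebra_simps)
    qed
    also have "\<dots> = rs_exp E p (\<lambda>R. of_bool (A i \<subseteq> R) * Z (I - J) R -
         x * (\<Sum>j\<in>J. of_bool (A i \<union> A j \<subseteq> R) * Z (I - J) R))"
      using E by (simp add: Bochner_Integration.integral_diff Bochner_Integration.integral_sum)
    also have "\<dots> = rs_exp E p (\<lambda>R. of_bool (A i \<subseteq> R) * ((1 - x * (\<Sum>j\<in>J. of_bool (A j \<subseteq> R))) * Z (I - J) R))"
      by (intro Bochner_Integration.integral_cong) (auto simp: algebra_simps sum_distrib_left sum_distrib_right)
    also have "\<dots> \<le> rs_exp E p (\<lambda>R. of_bool (A i \<subseteq> R) * Z I R)"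
      using E Z01 bern by (intro rs_exp_mono) (auto simp: Zsplit intro!: mult_right_mono)
    finally show ?thesis .
  next
    case False
    have "(?pi - x * D) * rs_exp E p (Z I) \<le> 0"
      using False Z01 by (intro mult_nonpos_nonneg Bochner_Integration.integral_nonneg) auto
    also have "0 \<le> rs_exp E p (\<lambda>R. of_bool (A i \<subseteq> R) * Z I R)"
      using Z01 by (intro Bochner_Integration.integral_nonneg) auto
    finally show ?thesis .
  qed
  have Z0: "0 \<le> rs_exp E p (Z I)" using Z01 by (intro Bochner_Integration.integral_nonneg) auto
  have "rs_exp E p (Z (insert i I)) = rs_exp E p (\<lambda>R. Z I R - x * (of_bool (A i \<subseteq> R) * Z I R))"
    unfolding Z_def using insert.hyps by (intro Bochner_Integration.integral_cong) (auto simp: algebra_simps)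
  also have "\<dots> = rs_exp E p (Z I) - x * rs_exp E p (\<lambda>R. of_bool (A i \<subseteq> R) * Z I R)"
    using E by simp
  also have "\<dots> \<le> (1 + (- x * ?pi + x\<^sup>2 * D)) * rs_exp E p (Z I)"
    using mult_left_mono[OF key x(1)] by (simp add: algebra_simps power2_eq_square)
  also have "\<dots> \<le> exp (- x * ?pi + x\<^sup>2 * D) * rs_exp E p (Z I)"
    using Z0 by (intro mult_right_mono exp_ge_add_one_self)
  also have "\<dots> \<le> exp (- x * ?pi + x\<^sup>2 * D) * exp (- x * (\<Sum>i\<in>I. p ^ card (A i)) +
         x\<^sup>2 * (\<Sum>i\<in>I. \<Sum>j\<in>{j\<in>I. j \<noteq> i \<and> A i \<inter> A j \<noteq> {}}. p ^ card (A i \<union> A j)))"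
    using insert.IH insert.prems unfolding Z_def by (intro mult_left_mono) auto
  also have "\<dots> \<le> exp (- x * (\<Sum>i\<in>insert i I. p ^ card (A i)) +
         x\<^sup>2 * (\<Sum>k\<in>insert i I. \<Sum>j\<in>{j\<in>insert i I. j \<noteq> k \<and> A k \<inter> A j \<noteq> {}}. p ^ card (A k \<union> A j)))"
  proof -
    have Deq: "(\<Sum>j\<in>{j\<in>insert i I. j \<noteq> i \<and> A i \<inter> A j \<noteq> {}}. p ^ card (A i \<union> A j)) = D"
      unfolding D_def J_def using insert.hyps by (intro sum.cong) auto
    \<comment> \<open>The right side counts an intersecting pair in both orders, whereas the
      induction produces it once. The slack consists of the terms j = i in the rows of the old
      indices.\<close>
    have le: "(\<Sum>k\<in>I. \<Sum>j\<in>{j\<in>I. j \<noteq> k \<and> A k \<inter> A j \<noteq> {}}. p ^ card (A k \<union> A j)) \<le>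
       (\<Sum>k\<in>I. \<Sum>j\<in>{j\<in>insert i I. j \<noteq> k \<and> A k \<inter> A j \<noteq> {}}. p ^ card (A k \<union> A j))"
      using insert.hyps E by (intro sum_mono sum_mono2) auto
    have "x\<^sup>2 * D + x\<^sup>2 * (\<Sum>k\<in>I. \<Sum>j\<in>{j\<in>I. j \<noteq> k \<and> A k \<inter> A j \<noteq> {}}. p ^ card (A k \<union> A j)) \<le>
       x\<^sup>2 * (\<Sum>k\<in>insert i I. \<Sum>j\<in>{j\<in>insert i I. j \<noteq> k \<and> A k \<inter> A j \<noteq> {}}. p ^ card (A k \<union> A j))"
      using mult_left_mono[OF le, of "x\<^sup>2"] insert.hyps
      unfolding sum.insert[OF insert.hyps] Deq by (simp add: distrib_left)
    moreover have "x * (\<Sum>i\<in>insert i I. p ^ card (A i)) = x * ?pi + x * (\<Sum>i\<in>I. p ^ card (A i))"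
      using insert.hyps by (simp add: distrib_left)
    ultimately show ?thesis unfolding exp_add[symmetric] by simp
  qed
  finally show ?case unfolding Z_def .
qed auto

section \<open>Markov's and Chebyshev's inequalities\<close>

lemma Markov_random_subset:
  assumes "finite E" "0 < c" "\<And>R. 0 \<le> h R"
  shows "measure_pmf.prob (random_subset E p) {R. c \<le> h R} \<le> rs_exp E p h / c"
  using integral_Markov_inequality_measure[of "measure_pmf (random_subset E p)" h "{}" c] assms
  by auto

text \<open>Disjoint sets A i, A j are present independently, so the variance is at most the
  diagonal plus the intersecting pairs. A second-moment bound is strong enough for the upper tail
  because the failure probability merely has to tend to 0.\<close>

lemma Chebyshev_superset_count:
  assumes E: "finite E" "0 \<le> p" "p \<le> 1" and I: "finite I" "\<And>i. i \<in> I \<Longrightarrow> A i \<subseteq> E" and t: "0 < t"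
  shows "measure_pmf.prob (random_subset E p)
           {R. (\<Sum>i\<in>I. p ^ card (A i)) + t \<le> real (card {i\<in>I. A i \<subseteq> R})} \<le>
    ((\<Sum>i\<in>I. p ^ card (A i)) +
     (\<Sum>i\<in>I. \<Sum>j\<in>{j\<in>I. j \<noteq> i \<and> A i \<inter> A j \<noteq> {}}. p ^ card (A i \<union> A j))) / t\<^sup>2"
proof -
  define \<mu> where "\<mu> = (\<Sum>i\<in>I. p ^ card (A i))"
  define \<Delta> where "\<Delta> = (\<Sum>i\<in>I. \<Sum>j\<in>{j\<in>I. j \<noteq> i \<and> A i \<inter> A j \<noteq> {}}. p ^ card (A i \<union> A j))"
  define X where "X = (\<lambda>R. \<Sum>i\<in>I. of_bool (A i \<subseteq> R) :: real)"
  have Xcard: "X R = real (card {i\<in>I. A i \<subseteq> R})" for R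
    unfolding X_def using I by (simp add: Int_def)
  have fin: "finite (A i)" if "i \<in> I" for i using that I E finite_subset by metis
  have EX: "rs_exp E p X = \<mu>" unfolding X_def \<mu>_def using E I
    by (subst Bochner_Integration.integral_sum) (auto intro!: sum.cong rs_exp_superset_prob)
  \<comment> \<open>A disjoint pair contributes exactly the product of the two means. Adding this
    product for all j, also for the dependent ones, only enlarges the right side, and it makes the
    square of the mean cancel below.\<close>
  have row: "(\<Sum>j\<in>I. p ^ card (A i \<union> A j)) \<le> p ^ card (A i) +
      (\<Sum>j\<in>{j\<in>I. j \<noteq> i \<and> A i \<inter> A j \<noteq> {}}. p ^ card (A i \<union> A j)) + p ^ card (A i) * \<mu>" if i: "i \<in> I" for i
  proof -
    let ?N = "{j\<in>I. j \<noteq> i \<and> A i \<inter> A j \<noteq> {}}"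
    have "(\<Sum>j\<in>I. p ^ card (A i \<union> A j)) \<le> (\<Sum>j\<in>I. of_bool (j = i) * p ^ card (A i) +
       of_bool (j \<in> ?N) * p ^ card (A i \<union> A j) + p ^ card (A i) * p ^ card (A j))"
    proof (rule sum_mono)
      fix j assume j: "j \<in> I"
      show "p ^ card (A i \<union> A j) \<le> of_bool (j = i) * p ^ card (A i) +
       of_bool (j \<in> ?N) * p ^ card (A i \<union> A j) + p ^ card (A i) * p ^ card (A j)"
      proof (cases "j = i \<or> j \<in> ?N")
        case True thus ?thesis using E by auto
      next
        case False
        hence "card (A i \<union> A j) = card (A i) + card (A j)" using i j fin by (intro card_Un_disjoint) auto
        thus ?thesis using False E by (auto simp: power_add)
      qed
    qed
    also have "\<dots> = p ^ card (A i) + (\<Sum>j\<in>?N. p ^ card (A i \<union> A j)) + p ^ card (A i) * \<mu>"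
    proof -
      have "(\<Sum>j\<in>I. of_bool (j = i) * p ^ card (A i)) = p ^ card (A i)"
        using i I by (simp add: of_bool_def if_distrib[of "\<lambda>z. z * _"] sum.delta cong: if_cong)
      moreover have "(\<Sum>j\<in>I. of_bool (j \<in> ?N) * p ^ card (A i \<union> A j)) = (\<Sum>j\<in>?N. p ^ card (A i \<union> A j))"
        using I by (intro sum.mono_neutral_cong_right) auto
      ultimately show ?thesis by (simp add: sum.distrib \<mu>_def sum_distrib_left)
    qed
    finally show ?thesis .
  qed
  have pair: "rs_exp E p (\<lambda>R. of_bool (A i \<union> A j \<subseteq> R)) = p ^ card (A i \<union> A j)"
    if "i \<in> I" "j \<in> I" for i j
    using that I by (intro rs_exp_superset_prob E) auto
  have "rs_exp E p (\<lambda>R. (X R)\<^sup>2) = rs_exp E p (\<lambda>R. \<Sum>i\<in>I. \<Sum>j\<in>I. of_bool (A i \<union> A j \<subseteq> R))"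
    unfolding X_def power2_eq_square sum_product
    by (intro Bochner_Integration.integral_cong sum.cong) auto
  also have "\<dots> = (\<Sum>i\<in>I. \<Sum>j\<in>I. p ^ card (A i \<union> A j))"
    using E pair by (simp add: Bochner_Integration.integral_sum del: Un_subset_iff sum_of_bool_eq)
  also have "\<dots> \<le> (\<Sum>i\<in>I. p ^ card (A i) +
      (\<Sum>j\<in>{j\<in>I. j \<noteq> i \<and> A i \<inter> A j \<noteq> {}}. p ^ card (A i \<union> A j)) + p ^ card (A i) * \<mu>)"
    by (intro sum_mono row)
  also have "\<dots> = \<mu> + \<Delta> + \<mu>\<^sup>2"
    by (simp add: sum.distrib \<mu>_def \<Delta>_def power2_eq_square sum_distrib_right)
  finally have EX2: "rs_exp E p (\<lambda>R. (X R)\<^sup>2) \<le> \<mu> + \<Delta> + \<mu>\<^sup>2" .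
  have "rs_exp E p (\<lambda>R. (X R - \<mu>)\<^sup>2) = rs_exp E p (\<lambda>R. (X R)\<^sup>2) - 2 * \<mu> * rs_exp E p X + \<mu>\<^sup>2"
    using E by (simp add: power2_diff algebra_simps)
  hence var: "rs_exp E p (\<lambda>R. (X R - \<mu>)\<^sup>2) \<le> \<mu> + \<Delta>"
    using EX2 EX by (simp add: power2_eq_square algebra_simps)
  have "measure_pmf.prob (random_subset E p) {R. \<mu> + t \<le> X R} \<le>
        measure_pmf.prob (random_subset E p) {R. t\<^sup>2 \<le> (X R - \<mu>)\<^sup>2}"
    using t by (intro measure_pmf.finite_measure_mono) (auto intro!: power_mono)
  also have "\<dots> \<le> rs_exp E p (\<lambda>R. (X R - \<mu>)\<^sup>2) / t\<^sup>2"
    using E t by (intro Markov_random_subset) auto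
  also have "\<dots> \<le> (\<mu> + \<Delta>) / t\<^sup>2" using var t by (simp add: divide_right_mono)
  finally show ?thesis unfolding \<mu>_def \<Delta>_def Xcard .
qed

section \<open>Cliques and clique factors\<close>

lemma finite_all_edges [simp]: "finite V \<Longrightarrow> finite (all_edges V)"
  by (simp add: all_edges_def)

lemma card_all_edges: "finite V \<Longrightarrow> card (all_edges V) = card V choose 2"
  unfolding all_edges_def by (rule n_subsets)

lemma all_edges_mono: "V \<subseteq> W \<Longrightarrow> all_edges V \<subseteq> all_edges W"
  by (auto simp: all_edges_def)

lemma all_edges_Int: "all_edges V \<inter> all_edges W = all_edges (V \<inter> W)"
  by (auto simp: all_edges_def)

definition k_sets :: "nat \<Rightarrow> nat \<Rightarrow> nat set set" where
  "k_sets n r = {S. S \<subseteq> {..<n} \<and> card S = r}"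

lemma finite_k_sets [simp]: "finite (k_sets n r)"
  by (simp add: k_sets_def)

lemma card_k_sets: "card (k_sets n r) = n choose r"
  unfolding k_sets_def using n_subsets[of "{..<n}" r] by simp

lemma k_setsD: "S \<in> k_sets n r \<Longrightarrow> S \<subseteq> {..<n} \<and> finite S \<and> card S = r"
  by (auto simp: k_sets_def intro: finite_subset)

lemma card_all_edges_k_sets: "S \<in> k_sets n r \<Longrightarrow> card (all_edges S) = r choose 2"
  using k_setsD[of S n r] by (simp add: card_all_edges)

lemma binomial_le_power: "n choose k \<le> n ^ k"
  by (cases "k \<le> n") (auto simp: binomial_le_pow binomial_eq_0)

lemma card_k_sets_superset:
  assumes "finite e"
  shows "card {S \<in> k_sets n r. e \<subseteq> S} \<le> n ^ (r - card e)"
proof -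
  have "card {S \<in> k_sets n r. e \<subseteq> S} \<le> card (k_sets n (r - card e))"
  proof (rule card_inj_on_le)
    show "inj_on (\<lambda>S. S - e) {S \<in> k_sets n r. e \<subseteq> S}" by (auto simp: inj_on_def)
    show "(\<lambda>S. S - e) ` {S \<in> k_sets n r. e \<subseteq> S} \<subseteq> k_sets n (r - card e)"
      using assms by (auto simp: k_sets_def card_Diff_subset)
  qed auto
  also have "\<dots> \<le> n ^ (r - card e)" unfolding card_k_sets by (rule binomial_le_power)
  finally show ?thesis .
qed

lemma card_k_sets_inter:
  assumes S: "S \<in> k_sets n r"
  shows "card {T \<in> k_sets n r. card (S \<inter> T) = s} \<le> (r choose s) * n ^ (r - s)"
proof -
  have "card {T \<in> k_sets n r. card (S \<inter> T) = s} \<le> card ({U. U \<subseteq> S \<and> card U = s} \<times> k_sets n (r - s))"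
  proof (rule card_inj_on_le)
    show "inj_on (\<lambda>T. (S \<inter> T, T - S)) {T \<in> k_sets n r. card (S \<inter> T) = s}"
      by (auto simp: inj_on_def)
    have "card (T - S) = r - s" if "T \<in> k_sets n r" "card (S \<inter> T) = s" for T
      using that k_setsD[OF that(1)] by (metis card_Diff_subset_Int finite_Int inf_commute)
    thus "(\<lambda>T. (S \<inter> T, T - S)) ` {T \<in> k_sets n r. card (S \<inter> T) = s} \<subseteq>
        {U. U \<subseteq> S \<and> card U = s} \<times> k_sets n (r - s)"
      by (auto simp: k_sets_def)
  qed (use k_setsD[OF S] in auto)
  also have "\<dots> = (r choose s) * (n choose (r - s))"
    using k_setsD[OF S] by (simp add: card_cartesian_product n_subsets card_k_sets)
  also have "\<dots> \<le> (r choose s) * n ^ (r - s)" by (intro mult_left_mono binomial_le_power) auto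
  finally show ?thesis .
qed

definition meeting :: "nat \<Rightarrow> nat \<Rightarrow> nat set \<Rightarrow> nat set set" where
  "meeting n r S = {T \<in> k_sets n r. T \<noteq> S \<and> all_edges S \<inter> all_edges T \<noteq> {}}"

lemma finite_meeting [simp]: "finite (meeting n r S)"
  by (simp add: meeting_def)

lemma meeting_inter:
  assumes "S \<in> k_sets n r" "T \<in> meeting n r S"
  shows "card (S \<inter> T) \<in> {2..<r}"
proof -
  have S: "finite S" "card S = r" and T: "finite T" "card T = r"
    using assms k_setsD unfolding meeting_def by blast+
  obtain e where e: "e \<subseteq> S \<inter> T" "card e = 2"
    using assms(2) by (auto simp: meeting_def all_edges_Int) (auto simp: all_edges_def)
  have "2 \<le> card (S \<inter> T)" using e S card_mono[of "S \<inter> T" e] by auto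
  moreover have "card (S \<inter> T) < r"
  proof -
    have "S \<inter> T \<noteq> S"
    proof
      assume "S \<inter> T = S"
      hence "S = T" using S T by (intro card_subset_eq) auto
      thus False using assms(2) by (auto simp: meeting_def)
    qed
    thus ?thesis using S by (metis inf_le1 psubsetI psubset_card_mono)
  qed
  ultimately show ?thesis by auto
qed

lemma card_all_edges_Un:
  assumes "S \<in> k_sets n r" "T \<in> k_sets n r"
  shows "card (all_edges S \<union> all_edges T) + (card (S \<inter> T) choose 2) = 2 * (r choose 2)"
  using card_Un_Int[of "all_edges S" "all_edges T"] k_setsD[OF assms(1)] k_setsD[OF assms(2)]
  by (simp add: card_all_edges all_edges_Int)

lemma binomial_two_mono: "a \<le> b \<Longrightarrow> a choose 2 \<le> b choose 2"
  by (rule binomial_right_mono)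

text \<open>A set T with s common vertices brings (r choose 2) - (s choose 2) new edges, and there
  are at most (r choose s) n^(r-s) such sets. The product of n^(r-s) and the power of p is, up to a
  constant, the expected number of r-cliques that extend a given s-clique; it governs the
  correlations both for Chebyshev's and for Janson's inequality.\<close>

lemma sum_meeting_le:
  assumes S: "S \<in> k_sets n r" and p: "0 \<le> p"
  shows "(\<Sum>T\<in>meeting n r S. p ^ card (all_edges S \<union> all_edges T)) \<le>
    p ^ (r choose 2) * (\<Sum>s=2..<r. real (r choose s) * (real n ^ (r - s) * p ^ ((r choose 2) - (s choose 2))))"
proof -
  have "(\<Sum>T\<in>meeting n r S. p ^ card (all_edges S \<union> all_edges T)) =
    (\<Sum>s=2..<r. \<Sum>T\<in>{T\<in>meeting n r S. card (S \<inter> T) = s}. p ^ card (all_edges S \<union> all_edges T))"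
    using meeting_inter[OF S] by (intro sum.group[symmetric]) auto
  also have "\<dots> \<le> (\<Sum>s=2..<r. real ((r choose s) * n ^ (r - s)) * (p ^ (r choose 2) * p ^ ((r choose 2) - (s choose 2))))"
  proof (rule sum_mono)
    fix s assume s: "s \<in> {2..<r}"
    let ?M = "{T\<in>meeting n r S. card (S \<inter> T) = s}"
    have le: "s choose 2 \<le> r choose 2" using s by (intro binomial_two_mono) auto
    have "p ^ card (all_edges S \<union> all_edges T) = p ^ (r choose 2) * p ^ ((r choose 2) - (s choose 2))"
      if "T \<in> ?M" for T
    proof -
      have "T \<in> k_sets n r" "card (S \<inter> T) = s" using that by (auto simp: meeting_def)
      hence "card (all_edges S \<union> all_edges T) = (r choose 2) + ((r choose 2) - (s choose 2))"
        using card_all_edges_Un[OF S, of T] le by simp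
      thus ?thesis by (simp add: power_add)
    qed
    hence "(\<Sum>T\<in>?M. p ^ card (all_edges S \<union> all_edges T)) =
        real (card ?M) * (p ^ (r choose 2) * p ^ ((r choose 2) - (s choose 2)))" by simp
    moreover have "card ?M \<le> (r choose s) * n ^ (r - s)"
      by (rule order.trans[OF card_mono card_k_sets_inter[OF S]]) (auto simp: meeting_def)
    ultimately show "(\<Sum>T\<in>?M. p ^ card (all_edges S \<union> all_edges T)) \<le>
       real ((r choose s) * n ^ (r - s)) * (p ^ (r choose 2) * p ^ ((r choose 2) - (s choose 2)))"
      using p by (simp only:) (intro mult_right_mono of_nat_mono, auto)
  qed
  finally show ?thesis by (simp add: sum_distrib_left mult_ac)
qed

section \<open>Factors, their edges and their number\<close>

definition factors :: "'a set \<Rightarrow> nat \<Rightarrow> 'a set set set" where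
  "factors V r = {P. partition_on V P \<and> (\<forall>A\<in>P. card A = r)}"

definition edges_of :: "'a set set \<Rightarrow> 'a set set" where
  "edges_of P = \<Union> (all_edges ` P)"

lemma num_clique_factors_eq:
  "num_clique_factors r V E = card {P \<in> factors V r. edges_of P \<subseteq> E}"
  unfolding num_clique_factors_def is_clique_factor_def factors_def edges_of_def
  by (rule arg_cong[where f = card]) auto

lemma finite_factors [simp]: "finite V \<Longrightarrow> finite (factors V r)"
  by (rule finite_subset[of _ "Pow (Pow V)"]) (auto simp: factors_def partition_on_def)

lemma factorsD:
  assumes "P \<in> factors V r" "finite V"
  shows "finite P" "\<And>A. A \<in> P \<Longrightarrow> A \<subseteq> V \<and> finite A \<and> card A = r" "\<Union> P = V" "disjoint P"
  using assms by (auto simp: factors_def partition_on_def intro: finite_subset[OF Union_upper] dest: finite_UnionD)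

lemma card_factor:
  assumes "P \<in> factors V r" "finite V"
  shows "card P * r = card V"
proof -
  note P = factorsD[OF assms]
  have "card V = (\<Sum>A\<in>P. card A)"
    unfolding P(3)[symmetric] using P by (intro card_Union_disjoint) (auto simp: disjoint_def disjnt_def pairwise_def)
  thus ?thesis using P by simp
qed

lemma card_edges_of:
  assumes "P \<in> factors V r" "finite V"
  shows "card (edges_of P) = card P * (r choose 2)"
proof -
  note P = factorsD[OF assms]
  have "card (edges_of P) = (\<Sum>A\<in>P. card (all_edges A))"
    unfolding edges_of_def
  proof (rule card_UN_disjoint)
    have "all_edges A \<inter> all_edges B = {}" if "A \<in> P" "B \<in> P" "A \<noteq> B" for A B
      using P(4) that unfolding all_edges_Int disjoint_def by (auto simp: all_edges_def)
    thus "\<forall>A\<in>P. \<forall>B\<in>P. A \<noteq> B \<longrightarrow> all_edges A \<inter> all_edges B = {}" by blast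
  qed (use P in auto)
  also have "\<dots> = (\<Sum>A\<in>P. r choose 2)"
    using P(2) by (intro sum.cong refl) (auto simp: card_all_edges)
  finally show ?thesis by simp
qed

lemma edges_of_subset: "P \<in> factors V r \<Longrightarrow> edges_of P \<subseteq> all_edges V"
  unfolding edges_of_def factors_def partition_on_def by (auto intro!: UN_least all_edges_mono)

text \<open>A factor is determined by the block of a fixed vertex v, for which there are at most
  (n-1 choose r-1) choices, and by the factor that remains on the other n - r vertices. The product
  form avoids division in the naturals.\<close>

lemma card_factors_le:
  assumes "finite V" "card V = r * k" "r > 0"
  shows "card (factors V r) * (fact r ^ k * fact k) \<le> (fact (r * k) :: nat)"
  using assms(1,2)
proof (induction k arbitrary: V)
  case 0
  hence "factors V r \<subseteq> {{}}" by (auto simp: factors_def partition_on_def)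
  hence "card (factors V r) \<le> 1" using card_mono[of "{{}}" "factors V r"] by simp
  thus ?case by simp
next
  case (Suc k)
  let ?n = "r * Suc k"
  obtain v where v: "v \<in> V" using Suc assms(3) by fastforce
  define \<B> where "\<B> = {B. B \<subseteq> V \<and> v \<in> B \<and> card B = r}"
  define b where "b = (\<lambda>P. THE B. B \<in> P \<and> v \<in> B)"
  have b: "b P \<in> P \<and> v \<in> b P" if "P \<in> factors V r" for P
  proof -
    have "\<exists>!B. B \<in> P \<and> v \<in> B"
    proof -
      obtain B where B: "B \<in> P" "v \<in> B" using factorsD(3)[OF \<open>P \<in> factors V r\<close> Suc.prems(1)] v by blast
      moreover have "B' = B" if "B' \<in> P" "v \<in> B'" for B'
        using factorsD(4)[OF \<open>P \<in> factors V r\<close> Suc.prems(1)] B that unfolding disjoint_def by blast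
      ultimately show ?thesis by blast
    qed
    from theI'[OF this] show ?thesis unfolding b_def .
  qed
  have finB: "finite \<B>" using Suc.prems by (auto simp: \<B>_def)
  have "card \<B> \<le> card {U. U \<subseteq> V - {v} \<and> card U = r - 1}"
  proof (rule card_inj_on_le)
    show "inj_on (\<lambda>B. B - {v}) \<B>" by (auto simp: inj_on_def \<B>_def)
    show "(\<lambda>B. B - {v}) ` \<B> \<subseteq> {U. U \<subseteq> V - {v} \<and> card U = r - 1}"
      by (auto simp: \<B>_def)
  qed (use Suc.prems in auto)
  also have "\<dots> = (?n - 1) choose (r - 1)"
    using Suc.prems v by (subst n_subsets) auto
  finally have cB: "card \<B> \<le> (?n - 1) choose (r - 1)" .
  have "card (factors V r) \<le> card (SIGMA B:\<B>. factors (V - B) r)"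
  proof (rule card_inj_on_le)
    show "inj_on (\<lambda>P. (b P, P - {b P})) (factors V r)"
    proof (rule inj_onI)
      fix P Q assume "P \<in> factors V r" "Q \<in> factors V r" "(b P, P - {b P}) = (b Q, Q - {b Q})"
      thus "P = Q" using b[of P] b[of Q] by (metis insert_Diff prod.inject)
    qed
    show "(\<lambda>P. (b P, P - {b P})) ` factors V r \<subseteq> (SIGMA B:\<B>. factors (V - B) r)"
    proof clarify
      fix P assume P: "P \<in> factors V r"
      note P' = factorsD[OF P Suc.prems(1)] and bP = b[OF P]
      have "b P \<in> \<B>" using P' bP by (auto simp: \<B>_def)
      moreover have "P - {b P} \<in> factors (V - b P) r"
      proof -
        have dj: "A \<inter> b P = {}" if "A \<in> P" "A \<noteq> b P" for A
          using P'(4) bP that unfolding disjoint_def by blast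
        have "\<Union> (P - {b P}) = \<Union> P - b P"
        proof
          show "\<Union> (P - {b P}) \<subseteq> \<Union> P - b P" using dj by blast
        qed blast
        hence "partition_on (V - b P) (P - {b P})"
          using P P'(3,4) by (intro partition_onI) (auto simp: factors_def partition_on_def disjoint_def disjnt_def)
        thus ?thesis using P by (simp add: factors_def)
      qed
      ultimately show "b P \<in> \<B> \<and> P - {b P} \<in> factors (V - b P) r" ..
    qed
  qed (use finB Suc.prems in auto)
  also have "\<dots> = (\<Sum>B\<in>\<B>. card (factors (V - B) r))"
    using finB Suc.prems by (intro card_SigmaI) auto
  finally have "card (factors V r) * (fact r ^ k * fact k) \<le> (\<Sum>B\<in>\<B>. card (factors (V - B) r) * (fact r ^ k * fact k))"
    unfolding sum_distrib_right[symmetric] by (rule mult_right_mono) auto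
  also have "\<dots> \<le> (\<Sum>B\<in>\<B>. fact (r * k))"
  proof (rule sum_mono)
    fix B assume "B \<in> \<B>"
    hence "B \<subseteq> V" "card B = r" by (auto simp: \<B>_def)
    hence "card (V - B) = r * k" using Suc.prems by (subst card_Diff_subset) (auto intro: finite_subset)
    thus "card (factors (V - B) r) * (fact r ^ k * fact k) \<le> fact (r * k)"
      using Suc.prems by (intro Suc.IH) auto
  qed
  also have "\<dots> = card \<B> * fact (r * k)" by (simp only: sum_constant of_nat_id)
  also have "\<dots> \<le> ((?n - 1) choose (r - 1)) * fact (r * k)"
    by (rule mult_right_mono[OF cB]) simp
  finally have *: "card (factors V r) * (fact r ^ k * fact k) \<le> ((?n - 1) choose (r - 1)) * fact (r * k)" .
  have sub: "?n - 1 - (r - 1) = r * k" "r - 1 \<le> ?n - 1" using assms(3) by auto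
  have bf: "fact (r - 1) * fact (r * k) * ((?n - 1) choose (r - 1)) = (fact (?n - 1) :: nat)"
    using binomial_fact_lemma[OF sub(2)] unfolding sub(1) .
  have fr: "fact r = r * (fact (r - 1) :: nat)" using fact_reduce[OF assms(3), where ?'a = nat] by simp
  have "?n > 0" using assms(3) by simp
  hence fn: "fact ?n = ?n * (fact (?n - 1) :: nat)" using fact_reduce[where ?'a = nat, of ?n] by (simp only: of_nat_id)
  have "card (factors V r) * (fact r ^ Suc k * fact (Suc k)) =
      card (factors V r) * (fact r ^ k * fact k) * (fact r * Suc k)"
    by (simp only: fact_Suc power_Suc of_nat_id mult_ac)
  also have "\<dots> \<le> ((?n - 1) choose (r - 1)) * fact (r * k) * (fact r * Suc k)"
    by (rule mult_right_mono[OF *]) simp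
  also have "\<dots> = ?n * (fact (r - 1) * fact (r * k) * ((?n - 1) choose (r - 1)))"
    unfolding fr by (simp only: mult_ac)
  also have "\<dots> = fact ?n" unfolding bf fn ..
  finally show ?case .
qed

section \<open>Copies completed outside a planted factor\<close>

text \<open>Once P is planted, these are the edges of S that are still random.\<close>

definition residual :: "nat set set \<Rightarrow> nat set \<Rightarrow> nat set set" where
  "residual P S = all_edges S - edges_of P"

text \<open>The correlation sum of \<open>Janson_product\<close> for the residual sets, over ordered
  pairs.\<close>

definition residual_pairs :: "real \<Rightarrow> nat set set \<Rightarrow> nat set set \<Rightarrow> real" where
  "residual_pairs p P I = (\<Sum>S\<in>I. \<Sum>T\<in>{T\<in>I. T \<noteq> S \<and> residual P S \<inter> residual P T \<noteq> {}}.
     p ^ card (residual P S \<union> residual P T))"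

lemma factor_in_k_sets: "P \<in> factors {..<n} r \<Longrightarrow> P \<subseteq> k_sets n r"
  by (auto simp: factors_def k_sets_def partition_on_def)

lemma card_factor_edges:
  assumes "P \<in> factors {..<n} r" "n = r * k" "r > 0"
  shows "card P = k" "card (edges_of P) = k * (r choose 2)" "finite (edges_of P)" "finite P"
proof -
  show k: "card P = k" using card_factor[OF assms(1)] assms by simp
  show "card (edges_of P) = k * (r choose 2)" using card_edges_of[OF assms(1)] k by simp
  show "finite (edges_of P)" using edges_of_subset[OF assms(1)] finite_subset by fastforce
  show "finite P" using factorsD(1)[OF assms(1)] by simp
qed

lemma residual_meeting:
  "I \<subseteq> k_sets n r \<Longrightarrow> {T\<in>I. T \<noteq> S \<and> residual P S \<inter> residual P T \<noteq> {}} \<subseteq> meeting n r S"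
  unfolding residual_def meeting_def by blast

text \<open>Each of the k (r choose 2) planted edges lies in at most n^(r-2) sets. This bounds the
  number of copies that are given up when r \<ge> 4.\<close>

lemma disjoint_family_card:
  assumes P: "P \<in> factors {..<n} r" "n = r * k" "r > 0"
  shows "n choose r \<le> card {S \<in> k_sets n r. all_edges S \<inter> edges_of P = {}} +
     k * (r choose 2) * n ^ (r - 2)"
proof -
  let ?I = "{S \<in> k_sets n r. all_edges S \<inter> edges_of P = {}}"
  let ?J = "\<lambda>e. {S \<in> k_sets n r. e \<subseteq> S}"
  note ce = card_factor_edges[OF P]
  have e2: "card e = 2 \<and> finite e" if "e \<in> edges_of P" for e
    using that edges_of_subset[OF P(1)] finite_subset[of e "{..<n}"] by (auto simp: all_edges_def)
  have "k_sets n r \<subseteq> ?I \<union> (\<Union>e\<in>edges_of P. ?J e)" by (auto simp: all_edges_def)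
  hence "card (k_sets n r) \<le> card (?I \<union> (\<Union>e\<in>edges_of P. ?J e))"
    using ce by (intro card_mono) auto
  also have "\<dots> \<le> card ?I + card (\<Union>e\<in>edges_of P. ?J e)" by (rule card_Un_le)
  also have "card (\<Union>e\<in>edges_of P. ?J e) \<le> (\<Sum>e\<in>edges_of P. card (?J e))"
    using ce by (intro card_UN_le) auto
  also have "\<dots> \<le> (\<Sum>e\<in>edges_of P. n ^ (r - 2))"
    using e2 card_k_sets_superset[of _ n r] by (intro sum_mono) metis
  also have "\<dots> = k * (r choose 2) * n ^ (r - 2)" using ce by simp
  finally show ?thesis by (simp add: card_k_sets)
qed

lemma disjoint_family_sums:
  assumes P: "P \<in> factors {..<n} r" "n = r * k" "r > 0" and p: "0 \<le> p" "p \<le> 1"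
  defines "I \<equiv> {S \<in> k_sets n r. all_edges S \<inter> edges_of P = {}}"
  shows "real (n choose r) * p ^ (r choose 2) - real (k * (r choose 2) * n ^ (r - 2)) * p ^ (r choose 2)
      \<le> (\<Sum>S\<in>I. p ^ card (residual P S))"
    and "residual_pairs p P I \<le> real (n choose r) * p ^ (r choose 2) *
      (\<Sum>s=2..<r. real (r choose s) * (real n ^ (r - s) * p ^ ((r choose 2) - (s choose 2))))"
proof -
  let ?D = "\<Sum>s=2..<r. real (r choose s) * (real n ^ (r - s) * p ^ ((r choose 2) - (s choose 2)))"
  have res: "residual P S = all_edges S" if "S \<in> I" for S
    using that by (auto simp: residual_def I_def)
  have IK: "I \<subseteq> k_sets n r" by (auto simp: I_def)
  have "(\<Sum>S\<in>I. p ^ card (residual P S)) = (\<Sum>S\<in>I. p ^ (r choose 2))"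
    using IK by (intro sum.cong refl) (auto simp: res card_all_edges_k_sets)
  hence eq: "(\<Sum>S\<in>I. p ^ card (residual P S)) = real (card I) * p ^ (r choose 2)" by simp
  have "real (n choose r) \<le> real (card I + k * (r choose 2) * n ^ (r - 2))"
    using disjoint_family_card[OF P] unfolding I_def by (intro of_nat_mono)
  hence "real (n choose r) - real (k * (r choose 2) * n ^ (r - 2)) \<le> real (card I)" by linarith
  from mult_right_mono[OF this, of "p ^ (r choose 2)"]
  show "real (n choose r) * p ^ (r choose 2) - real (k * (r choose 2) * n ^ (r - 2)) * p ^ (r choose 2)
      \<le> (\<Sum>S\<in>I. p ^ card (residual P S))" using p unfolding eq by (simp add: algebra_simps)
  have D0: "0 \<le> ?D" using p by (intro sum_nonneg) auto
  have "residual_pairs p P I \<le> (\<Sum>S\<in>I. p ^ (r choose 2) * ?D)"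
    unfolding residual_pairs_def
  proof (rule sum_mono)
    fix S assume S: "S \<in> I"
    have "(\<Sum>T\<in>{T\<in>I. T \<noteq> S \<and> residual P S \<inter> residual P T \<noteq> {}}. p ^ card (residual P S \<union> residual P T)) =
      (\<Sum>T\<in>{T\<in>I. T \<noteq> S \<and> residual P S \<inter> residual P T \<noteq> {}}. p ^ card (all_edges S \<union> all_edges T))"
      using S by (intro sum.cong) (auto simp: res)
    also have "\<dots> \<le> (\<Sum>T\<in>meeting n r S. p ^ card (all_edges S \<union> all_edges T))"
      using residual_meeting[OF IK] p by (intro sum_mono2) auto
    also have "\<dots> \<le> p ^ (r choose 2) * ?D" using S IK by (intro sum_meeting_le p) auto
    finally show "(\<Sum>T\<in>{T\<in>I. T \<noteq> S \<and> residual P S \<inter> residual P T \<noteq> {}}. p ^ card (residual P S \<union> residual P T))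
       \<le> p ^ (r choose 2) * ?D" .
  qed
  also have "\<dots> = real (card I) * (p ^ (r choose 2) * ?D)" by simp
  also have "\<dots> \<le> real (n choose r) * (p ^ (r choose 2) * ?D)"
    using card_mono[OF finite_k_sets IK] p D0
    by (intro mult_right_mono mult_nonneg_nonneg) (auto simp: card_k_sets)
  finally show "residual_pairs p P I \<le> real (n choose r) * p ^ (r choose 2) * ?D"
    by (simp add: mult_ac)
qed

section \<open>Triangles that use a planted edge\<close>

lemma triangle_planted_le_1:
  assumes P: "P \<in> factors {..<n} 3" and S: "S \<in> k_sets n 3" "S \<notin> P"
  shows "card (all_edges S \<inter> edges_of P) \<le> 1"
proof (rule ccontr)
  note P' = factorsD[OF P finite_lessThan]
  have S': "finite S" "card S = 3" using k_setsD[OF S(1)] by auto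
  assume "\<not> card (all_edges S \<inter> edges_of P) \<le> 1"
  then obtain e f where ef: "e \<in> all_edges S \<inter> edges_of P" "f \<in> all_edges S \<inter> edges_of P" "e \<noteq> f"
    using S' by (auto simp: card_le_Suc0_iff_eq)
  then obtain A B where AB: "A \<in> P" "e \<subseteq> A" "B \<in> P" "f \<subseteq> B"
    unfolding edges_of_def all_edges_def by blast
  have c: "e \<subseteq> S" "f \<subseteq> S" "card e = 2" "card f = 2" using ef by (auto simp: all_edges_def)
  hence fin: "finite e" "finite f" using S' finite_subset by auto
  \<comment> \<open>Two edges of a triangle share a vertex, so two planted edges of S lie in the
    same block, and then that block is S itself.\<close>
  have un: "card (e \<union> f) \<le> 3" using c S' card_mono[of S "e \<union> f"] by simp
  hence "card (e \<inter> f) > 0" using card_Un_Int[OF fin] c by simp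
  hence "e \<inter> f \<noteq> {}" by force
  hence "A \<inter> B \<noteq> {}" using AB by blast
  hence "A = B" using P'(4) AB unfolding disjoint_def by blast
  have "e \<union> f \<noteq> e"
  proof
    assume "e \<union> f = e"
    hence "f = e" using c fin by (intro card_subset_eq) auto
    thus False using ef by simp
  qed
  hence "card e < card (e \<union> f)" using fin by (intro psubset_card_mono) auto
  hence "e \<union> f = S" using c S' un by (intro card_subset_eq) auto
  hence "S \<subseteq> A" using AB \<open>A = B\<close> by auto
  hence "S = A" using S' P'(2)[OF AB(1)] by (intro card_subset_eq) auto
  thus False using AB S by simp
qed

text \<open>Double counting: each of the n planted edges forms a triangle outside P with every
  vertex outside its own block. The lower bound is the source of the gain n (n - 3) (p^2 - p^3) in
  \<open>triangle_family_sums\<close>.\<close>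

lemma triangle_planted_sum:
  assumes P: "P \<in> factors {..<n} 3" "n = 3 * k"
  shows "(\<Sum>S\<in>k_sets n 3 - P. card (all_edges S \<inter> edges_of P)) \<in> {n * (n - 3)..n * n}"
proof -
  note P' = factorsD[OF P(1) finite_lessThan]
  have ce: "card (edges_of P) = n" "finite (edges_of P)"
    using card_factor_edges[OF P] P(2) by (auto simp: numeral_3_eq_3 numeral_2_eq_2)
  have sw: "(\<Sum>S\<in>k_sets n 3 - P. card (all_edges S \<inter> edges_of P)) =
     (\<Sum>e\<in>edges_of P. card {S\<in>k_sets n 3 - P. e \<in> all_edges S})"
  proof -
    have "(\<Sum>S\<in>k_sets n 3 - P. card (all_edges S \<inter> edges_of P)) =
      (\<Sum>S\<in>k_sets n 3 - P. \<Sum>e\<in>edges_of P. of_bool (e \<in> all_edges S))"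
      using ce by (intro sum.cong refl) (simp add: Int_commute Int_def)
    also have "\<dots> = (\<Sum>e\<in>edges_of P. \<Sum>S\<in>k_sets n 3 - P. of_bool (e \<in> all_edges S))"
      by (rule sum.swap)
    also have "\<dots> = (\<Sum>e\<in>edges_of P. card {S\<in>k_sets n 3 - P. e \<in> all_edges S})"
      by (intro sum.cong refl) (simp add: Int_def)
    finally show ?thesis .
  qed
  have "card {S\<in>k_sets n 3 - P. e \<in> all_edges S} \<in> {n - 3..n}" if e: "e \<in> edges_of P" for e
  proof -
    obtain B where B: "B \<in> P" "e \<subseteq> B" and e2: "card e = 2"
      using e unfolding edges_of_def all_edges_def by blast
    note B' = P'(2)[OF B(1)]
    have fe: "finite e" using B B' finite_subset by auto
    have "card {S\<in>k_sets n 3 - P. e \<in> all_edges S} \<le> card {S\<in>k_sets n 3. e \<subseteq> S}"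
      by (intro card_mono) (auto simp: all_edges_def)
    also have "\<dots> \<le> n" using card_k_sets_superset[OF fe, of n 3] e2 by simp
    finally have up: "card {S\<in>k_sets n 3 - P. e \<in> all_edges S} \<le> n" .
    have "n - 3 = card ({..<n} - B)" using B' by (simp add: card_Diff_subset)
    also have "\<dots> \<le> card {S\<in>k_sets n 3 - P. e \<in> all_edges S}"
    proof (rule card_inj_on_le)
      show "inj_on (\<lambda>w. insert w e) ({..<n} - B)" using B by (auto simp: inj_on_def)
      show "(\<lambda>w. insert w e) ` ({..<n} - B) \<subseteq> {S\<in>k_sets n 3 - P. e \<in> all_edges S}"
      proof (rule image_subsetI)
        fix w assume "w \<in> {..<n} - B"
        hence w: "w \<in> {..<n}" "w \<notin> B" by auto
        hence "w \<notin> e" using B by auto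
        hence "insert w e \<in> k_sets n 3" using w B B' e2 fe by (auto simp: k_sets_def)
        moreover have "insert w e \<notin> P"
        proof
          assume a: "insert w e \<in> P"
          have "e \<noteq> {}" using e2 by auto
          hence "insert w e \<inter> B \<noteq> {}" using B by auto
          hence "insert w e = B" using disjointD[OF P'(4) a B(1)] by auto
          thus False using w by auto
        qed
        ultimately show "insert w e \<in> {S\<in>k_sets n 3 - P. e \<in> all_edges S}"
          using e2 by (auto simp: all_edges_def)
      qed
    qed auto
    finally show ?thesis using up by simp
  qed
  hence "(\<Sum>e\<in>edges_of P. n - 3) \<le> (\<Sum>e\<in>edges_of P. card {S\<in>k_sets n 3 - P. e \<in> all_edges S})"
    "(\<Sum>e\<in>edges_of P. card {S\<in>k_sets n 3 - P. e \<in> all_edges S}) \<le> (\<Sum>e\<in>edges_of P. n)"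
    by (auto intro!: sum_mono simp del: sum_constant)
  thus ?thesis using sw ce by simp
qed

text \<open>The constant is 3 times 2 times 3. T shares with S one of the 3 edges e of S, and e is
  not planted. As T also contains a planted edge, its third vertex lies in the block, of size 3, of
  one of the 2 ends of e.\<close>

lemma triangle_meeting_planted_card:
  assumes P: "P \<in> factors {..<n} 3" and S: "S \<in> k_sets n 3"
  shows "card {T\<in>k_sets n 3 - P. T \<noteq> S \<and> residual P S \<inter> residual P T \<noteq> {} \<and>
      all_edges T \<inter> edges_of P \<noteq> {}} \<le> 18" (is "card ?M \<le> _")
proof -
  note P' = factorsD[OF P finite_lessThan]
  have S': "finite S" "card S = 3" using k_setsD[OF S] by auto
  define blk where "blk = (\<lambda>u. \<Union>{B\<in>P. u \<in> B})"
  have blk: "blk u = B" if "B \<in> P" "u \<in> B" for u B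
  proof -
    have "{B\<in>P. u \<in> B} = {B}" using that P'(4) unfolding disjoint_def by blast
    thus ?thesis by (simp add: blk_def)
  qed
  have blkfin: "finite (blk u) \<and> card (blk u) \<le> 3" for u
  proof (cases "\<exists>B\<in>P. u \<in> B")
    case True
    then obtain B where "B \<in> P" "u \<in> B" by blast
    thus ?thesis using blk P'(2) by simp
  next
    case False
    hence "blk u = {}" by (auto simp: blk_def)
    thus ?thesis by simp
  qed
  define W where "W = (SIGMA e:all_edges S. SIGMA u:e. blk u)"
  have e2: "finite e \<and> card e = 2" if "e \<in> all_edges S" for e
    using that S' finite_subset by (auto simp: all_edges_def)
  have fW: "finite W" unfolding W_def using S' e2 blkfin by (intro finite_SigmaI) auto
  have "card W = (\<Sum>e\<in>all_edges S. card (SIGMA u:e. blk u))"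
    unfolding W_def using S' e2 blkfin by (intro card_SigmaI) auto
  also have "\<dots> \<le> (\<Sum>e\<in>all_edges S. 6)"
  proof (rule sum_mono)
    fix e assume e: "e \<in> all_edges S"
    have "card (SIGMA u:e. blk u) = (\<Sum>u\<in>e. card (blk u))"
      using e2[OF e] blkfin by (intro card_SigmaI) auto
    also have "\<dots> \<le> (\<Sum>u\<in>e. 3)" using blkfin by (intro sum_mono) auto
    also have "\<dots> = 6" using e2[OF e] by simp
    finally show "card (SIGMA u:e. blk u) \<le> 6" .
  qed
  also have "\<dots> = 18" using S' by (simp add: card_all_edges numeral_3_eq_3 numeral_2_eq_2)
  finally have cW: "card W \<le> 18" .
  have "?M \<subseteq> (\<lambda>(e, u, w). insert w e) ` W"
  proof clarify
    fix T assume T: "T \<in> k_sets n 3" "all_edges T \<inter> edges_of P \<noteq> {}" "residual P S \<inter> residual P T \<noteq> {}"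
    then obtain e f where e: "e \<in> all_edges S" "e \<in> all_edges T" "e \<notin> edges_of P"
      and f: "f \<in> all_edges T" "f \<in> edges_of P" unfolding residual_def by blast
    have T': "finite T" "card T = 3" using k_setsD[OF T(1)] by auto
    have c: "e \<subseteq> T" "f \<subseteq> T" "card e = 2" "card f = 2" using e f by (auto simp: all_edges_def)
    hence fin: "finite e" "finite f" using T' finite_subset by auto
    have "\<not> f \<subseteq> e" using card_subset_eq[of e f] c fin e f by auto
    then obtain w where w: "w \<in> f" "w \<notin> e" by blast
    have Teq: "insert w e = T" using w c fin T' by (intro card_subset_eq) auto
    have "card (f - {w}) = 1" using w c fin by simp
    then obtain u where "f - {w} = {u}" by (auto simp: card_1_singleton_iff)
    hence u: "u \<in> f" "u \<noteq> w" by auto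
    hence "u \<in> e" using c Teq by auto
    obtain B where "B \<in> P" "f \<subseteq> B" using f unfolding edges_of_def all_edges_def by blast
    hence "w \<in> blk u" using blk[of B u] u w by auto
    hence "(e, u, w) \<in> W" using e \<open>u \<in> e\<close> by (auto simp: W_def)
    thus "T \<in> (\<lambda>(e, u, w). insert w e) ` W" using Teq by (auto intro!: rev_image_eqI)
  qed
  hence "card ?M \<le> card W" using fW by (rule surj_card_le[rotated])
  thus ?thesis using cW by simp
qed

text \<open>By \<open>triangle_planted_le_1\<close> a triangle S outside P has a(S) \<in> {0, 1}
  planted edges, hence 3 - a(S) random ones, and two triangles that share a random edge have 5 -
  a(S) - a(T) random edges together. The three error terms correspond to pairs in which none, one or
  both of the triangles use a planted edge: each triangle meets at most 3 n others, at most n^2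
  triangles use a planted edge, and at most 18 of those meet a given triangle.\<close>

lemma triangle_family_sums:
  assumes P: "P \<in> factors {..<n} 3" "n = 3 * k" "k > 0" and p: "0 \<le> p" "p \<le> 1"
  defines "I \<equiv> k_sets n 3 - P"
  shows "real (n choose 3) * p ^ 3 - real k * p ^ 3 + real n * (real n - 3) * (p\<^sup>2 - p ^ 3)
      \<le> (\<Sum>S\<in>I. p ^ card (residual P S))"
    and "residual_pairs p P I \<le> 3 * real n * real (n choose 3) * p ^ 5 + 6 * real n ^ 3 * p ^ 4 + 18 * (real n)\<^sup>2 * p ^ 3"
proof -
  have n3: "n \<ge> 3" using P by auto
  define a where "a = (\<lambda>S. card (all_edges S \<inter> edges_of P))"
  have a1: "a S = 0 \<or> a S = 1" if "S \<in> I" for S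
    using triangle_planted_le_1[OF P(1), of S] that unfolding a_def I_def by auto
  have IK: "I \<subseteq> k_sets n 3" and fI: "finite I" by (auto simp: I_def)
  have sa: "n * (n - 3) \<le> (\<Sum>S\<in>I. a S)" "(\<Sum>S\<in>I. a S) \<le> n * n"
    using triangle_planted_sum[OF P(1,2)] unfolding a_def I_def by auto
  have K: "finite S \<and> finite (all_edges S) \<and> card (all_edges S) = 3" if "S \<in> I" for S
    using that IK k_setsD[of S n 3] card_all_edges_k_sets[of S n 3] by (auto simp: numeral_3_eq_3 numeral_2_eq_2)
  have cr: "card (residual P S) + a S = 3" if "S \<in> I" for S
  proof -
    have "card (residual P S) = card (all_edges S) - a S"
      unfolding residual_def a_def using K[OF that] by (intro card_Diff_subset_Int) auto
    thus ?thesis using K[OF that] a1[OF that] by auto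
  qed
  have cI: "card I = (n choose 3) - k"
    unfolding I_def using card_factor_edges[OF P(1,2)] factor_in_k_sets[OF P(1)]
    by (subst card_Diff_subset) (auto simp: card_k_sets)
  have kN: "k \<le> n choose 3"
    using card_mono[OF finite_k_sets factor_in_k_sets[OF P(1)]] card_factor_edges[OF P(1,2)]
    by (simp add: card_k_sets)
  have p32: "p ^ 3 \<le> p\<^sup>2" using p by (intro power_decreasing) auto
  have "real n * (real n - 3) = real (n * (n - 3))" using n3 by (simp add: of_nat_diff)
  also have "\<dots> \<le> real (\<Sum>S\<in>I. a S)" using sa(1) by (rule of_nat_mono)
  finally have sa': "real n * (real n - 3) \<le> (\<Sum>S\<in>I. real (a S))" by simp
  have "(\<Sum>S\<in>I. p ^ card (residual P S)) = (\<Sum>S\<in>I. p ^ 3 + (p\<^sup>2 - p ^ 3) * real (a S))"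
  proof (intro sum.cong refl)
    fix S assume "S \<in> I"
    from a1[OF this] cr[OF this] show "p ^ card (residual P S) = p ^ 3 + (p\<^sup>2 - p ^ 3) * real (a S)"
      by (auto simp: numeral_2_eq_2 numeral_3_eq_3)
  qed
  also have "\<dots> = real (card I) * p ^ 3 + (p\<^sup>2 - p ^ 3) * (\<Sum>S\<in>I. real (a S))"
    by (simp add: sum.distrib sum_distrib_left)
  finally have eq: "(\<Sum>S\<in>I. p ^ card (residual P S)) =
     real (card I) * p ^ 3 + (p\<^sup>2 - p ^ 3) * (\<Sum>S\<in>I. real (a S))" .
  have "(p\<^sup>2 - p ^ 3) * (real n * (real n - 3)) \<le> (p\<^sup>2 - p ^ 3) * (\<Sum>S\<in>I. real (a S))"
    using sa' p32 by (intro mult_left_mono) auto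
  thus "real (n choose 3) * p ^ 3 - real k * p ^ 3 + real n * (real n - 3) * (p\<^sup>2 - p ^ 3)
      \<le> (\<Sum>S\<in>I. p ^ card (residual P S))"
    unfolding eq cI using kN by (simp add: of_nat_diff algebra_simps)
  define nb where "nb = (\<lambda>S. {T\<in>I. T \<noteq> S \<and> residual P S \<inter> residual P T \<noteq> {}})"
  have nbI: "nb S \<subseteq> I" "finite (nb S)" for S using fI by (auto simp: nb_def)
  have nb3: "card (nb S) \<le> 3 * n" if S: "S \<in> I" for S
  proof -
    have Sk: "S \<in> k_sets n 3" using S IK by auto
    have "nb S \<subseteq> {T \<in> k_sets n 3. card (S \<inter> T) = 2}"
      using residual_meeting[OF IK, of S P] meeting_inter[OF Sk] IK unfolding nb_def by fastforce
    hence "card (nb S) \<le> card {T \<in> k_sets n 3. card (S \<inter> T) = 2}" by (intro card_mono) auto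
    also have "\<dots> \<le> (3 choose 2) * n ^ (3 - 2)" by (rule card_k_sets_inter[OF Sk])
    finally show ?thesis by (simp add: numeral_3_eq_3 numeral_2_eq_2)
  qed
  have pw: "p ^ card (residual P S \<union> residual P T) \<le>
     p ^ 5 + (real (a S) + real (a T)) * p ^ 4 + real (a S) * real (a T) * p ^ 3"
    if S: "S \<in> I" and T: "T \<in> nb S" for S T
  proof -
    have TI: "T \<in> I" using T by (auto simp: nb_def)
    have Sk: "S \<in> k_sets n 3" using S IK by auto
    have "T \<in> meeting n 3 S" using residual_meeting[OF IK, of S P] T unfolding nb_def by auto
    hence "card (S \<inter> T) = 2" using meeting_inter[OF Sk] by fastforce
    hence "card (all_edges S \<inter> all_edges T) = 1" unfolding all_edges_Int using K[OF S] by (simp add: card_all_edges)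
    hence "card (residual P S \<inter> residual P T) \<le> 1"
      using card_mono[of "all_edges S \<inter> all_edges T" "residual P S \<inter> residual P T"] K[OF S]
      by (auto simp: residual_def)
    moreover have fin: "finite (residual P S)" "finite (residual P T)"
      using K[OF S] K[OF TI] by (auto simp: residual_def)
    moreover have "card (residual P S \<inter> residual P T) \<noteq> 0" using T fin by (auto simp: nb_def)
    ultimately have "card (residual P S \<inter> residual P T) = 1" by linarith
    hence "card (residual P S \<union> residual P T) + a S + a T = 5"
      using card_Un_Int[OF fin] cr[OF S] cr[OF TI] by linarith
    moreover have "0 \<le> p ^ 5" "0 \<le> p ^ 4" "0 \<le> p ^ 3" using p by auto
    ultimately consider "a S = 0" "a T = 0" "card (residual P S \<union> residual P T) = 5"
      | "a S = 1" "a T = 0" "card (residual P S \<union> residual P T) = 4"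
      | "a S = 0" "a T = 1" "card (residual P S \<union> residual P T) = 4"
      | "a S = 1" "a T = 1" "card (residual P S \<union> residual P T) = 3"
      using a1[OF S] a1[OF TI] by auto
    thus ?thesis using \<open>0 \<le> p ^ 5\<close> \<open>0 \<le> p ^ 4\<close> \<open>0 \<le> p ^ 3\<close> by cases auto
  qed
  have sumaN: "(\<Sum>S\<in>I. real (a S)) \<le> (real n)\<^sup>2"
  proof -
    have "real (\<Sum>S\<in>I. a S) \<le> real (n * n)" using sa(2) by (rule of_nat_mono)
    thus ?thesis by (simp add: power2_eq_square)
  qed
  have const: "(\<Sum>T\<in>nb S. c) \<le> real (3 * n) * c" if "S \<in> I" "0 \<le> c" for S c
    unfolding sum_constant using that by (intro mult_right_mono of_nat_mono nb3) auto
  have b1: "(\<Sum>S\<in>I. \<Sum>T\<in>nb S. p ^ 5) \<le> 3 * real n * real (n choose 3) * p ^ 5"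
  proof -
    have "(\<Sum>S\<in>I. \<Sum>T\<in>nb S. p ^ 5) \<le> (\<Sum>S\<in>I. real (3 * n) * p ^ 5)"
      using p by (intro sum_mono const) auto
    also have "\<dots> = real (card I) * (real (3 * n) * p ^ 5)" by simp
    also have "\<dots> \<le> real (n choose 3) * (real (3 * n) * p ^ 5)"
      using cI p by (intro mult_right_mono) auto
    finally show ?thesis by (simp add: mult_ac)
  qed
  have aS: "(\<Sum>S\<in>I. \<Sum>T\<in>nb S. real (a S)) \<le> 3 * real n ^ 3"
  proof -
    have "(\<Sum>S\<in>I. \<Sum>T\<in>nb S. real (a S)) \<le> (\<Sum>S\<in>I. real (3 * n) * real (a S))"
      by (intro sum_mono const) auto
    also have "\<dots> = real (3 * n) * (\<Sum>S\<in>I. real (a S))" by (simp only: sum_distrib_left)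
    also have "\<dots> \<le> real (3 * n) * (real n)\<^sup>2" by (intro mult_left_mono sumaN) auto
    finally show ?thesis by (simp add: power2_eq_square power3_eq_cube mult_ac)
  qed
  have "(\<Sum>S\<in>I. \<Sum>T\<in>nb S. real (a T)) = (\<Sum>T\<in>I. \<Sum>S\<in>{S\<in>I. T \<noteq> S \<and> residual P S \<inter> residual P T \<noteq> {}}. real (a T))"
    unfolding nb_def by (rule sum.swap_restrict[OF fI fI])
  also have "\<dots> = (\<Sum>S\<in>I. \<Sum>T\<in>nb S. real (a S))"
    unfolding nb_def by (intro sum.cong refl) auto
  finally have aT: "(\<Sum>S\<in>I. \<Sum>T\<in>nb S. real (a T)) \<le> 3 * real n ^ 3" using aS by simp
  have aST: "(\<Sum>S\<in>I. \<Sum>T\<in>nb S. real (a S) * real (a T)) \<le> 18 * (real n)\<^sup>2"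
  proof -
    have in18: "(\<Sum>T\<in>nb S. real (a T)) \<le> 18" if S: "S \<in> I" for S
    proof -
      let ?M = "{T\<in>nb S. all_edges T \<inter> edges_of P \<noteq> {}}"
      have "(\<Sum>T\<in>nb S. real (a T)) = (\<Sum>T\<in>?M. real (a T))"
        using nbI by (intro sum.mono_neutral_right) (auto simp: a_def)
      also have "\<dots> \<le> (\<Sum>T\<in>?M. 1)"
        using nbI(1)[of S] a1 by (intro sum_mono) fastforce
      also have "\<dots> = real (card ?M)" by simp
      also have "card ?M \<le> card {T\<in>k_sets n 3 - P. T \<noteq> S \<and> residual P S \<inter> residual P T \<noteq> {} \<and>
        all_edges T \<inter> edges_of P \<noteq> {}}"
        by (intro card_mono) (auto simp: nb_def I_def)
      also have "\<dots> \<le> 18" using S IK by (intro triangle_meeting_planted_card P(1)) auto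
      finally show ?thesis by simp
    qed
    have "(\<Sum>S\<in>I. \<Sum>T\<in>nb S. real (a S) * real (a T)) = (\<Sum>S\<in>I. real (a S) * (\<Sum>T\<in>nb S. real (a T)))"
      by (simp add: sum_distrib_left)
    also have "\<dots> \<le> (\<Sum>S\<in>I. real (a S) * 18)"
      by (intro sum_mono mult_left_mono in18) auto
    also have "\<dots> = (\<Sum>S\<in>I. real (a S)) * 18" by (simp only: sum_distrib_right)
    also have "\<dots> \<le> 18 * (real n)\<^sup>2" using sumaN by simp
    finally show ?thesis .
  qed
  have "residual_pairs p P I = (\<Sum>S\<in>I. \<Sum>T\<in>nb S. p ^ card (residual P S \<union> residual P T))"
    by (simp add: residual_pairs_def nb_def)
  also have "\<dots> \<le> (\<Sum>S\<in>I. \<Sum>T\<in>nb S. p ^ 5 + (real (a S) + real (a T)) * p ^ 4 + real (a S) * real (a T) * p ^ 3)"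
    by (intro sum_mono pw)
  also have "\<dots> = (\<Sum>S\<in>I. \<Sum>T\<in>nb S. p ^ 5) + ((\<Sum>S\<in>I. \<Sum>T\<in>nb S. real (a S)) + (\<Sum>S\<in>I. \<Sum>T\<in>nb S. real (a T))) * p ^ 4 +
      (\<Sum>S\<in>I. \<Sum>T\<in>nb S. real (a S) * real (a T)) * p ^ 3"
    by (simp add: sum.distrib sum_distrib_right distrib_right del: sum_constant)
  also have "\<dots> \<le> 3 * real n * real (n choose 3) * p ^ 5 + (3 * real n ^ 3 + 3 * real n ^ 3) * p ^ 4 + 18 * (real n)\<^sup>2 * p ^ 3"
    using p by (intro add_mono b1 mult_right_mono aS aT aST) auto
  finally show "residual_pairs p P I \<le> 3 * real n * real (n choose 3) * p ^ 5 + 6 * real n ^ 3 * p ^ 4 + 18 * (real n)\<^sup>2 * p ^ 3"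
    by simp
qed

section \<open>Moments of the number of factors\<close>

text \<open>The tilt (1-x)^Y depends only on edges outside P. Planting P therefore leaves it
  unchanged and contributes exactly the k-th power of p^(r choose 2), and Janson's inequality
  applies to the residual sets. The family \<open>I P\<close> and the bound \<open>B\<close> are
  left open because r = 3 and r \<ge> 4 use different families.\<close>

lemma truncated_factor_moment:
  fixes I :: "nat set set \<Rightarrow> nat set set"
  assumes n: "n = r * k" "r > 0" and p: "0 \<le> p" "p \<le> 1" and x: "0 \<le> x" "x < 1" and "k \<le> M"
    and I: "\<And>P. P \<in> factors {..<n} r \<Longrightarrow> I P \<subseteq> k_sets n r - P"
    and B: "\<And>P. P \<in> factors {..<n} r \<Longrightarrow>
      - x * (\<Sum>S\<in>I P. p ^ card (residual P S)) + x\<^sup>2 * residual_pairs p P (I P) \<le> B"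
  shows "rs_exp (all_edges {..<n}) p (\<lambda>R. real (num_clique_factors r {..<n} R) *
      of_bool (card {S\<in>k_sets n r. all_edges S \<subseteq> R} \<le> M)) \<le>
    real (card (factors {..<n} r)) * (p ^ (r choose 2)) ^ k * exp B / (1 - x) ^ (M - k)"
proof -
  let ?E = "all_edges {..<n}" and ?F = "factors {..<n} r"
  define h where "h = (\<lambda>P R. \<Prod>S\<in>I P. 1 - x * of_bool (residual P S \<subseteq> R))"
  have fI: "finite (I P)" if "P \<in> ?F" for P using finite_subset[OF I[OF that]] by auto
  have h0: "0 \<le> h P R" for P R unfolding h_def using x by (intro prod_nonneg) auto
  have pw: "of_bool (edges_of P \<subseteq> R) * of_bool (card {S\<in>k_sets n r. all_edges S \<subseteq> R} \<le> M) \<le>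
      of_bool (edges_of P \<subseteq> R) * h P R / (1 - x) ^ (M - k)" if P: "P \<in> ?F" for P R
  proof (cases "edges_of P \<subseteq> R \<and> card {S\<in>k_sets n r. all_edges S \<subseteq> R} \<le> M")
    case True
    define Y where "Y = {S\<in>I P. residual P S \<subseteq> R}"
    have Y: "finite Y" "Y \<inter> P = {}" using fI[OF P] I[OF P] by (auto simp: Y_def)
    \<comment> \<open>A residual set inside R completes a copy together with the planted edges. The
      k blocks are further copies, disjoint from Y, which yields the exponent M - k.\<close>
    have "Y \<union> P \<subseteq> {S\<in>k_sets n r. all_edges S \<subseteq> R}"
      using True I[OF P] factor_in_k_sets[OF P] unfolding Y_def residual_def edges_of_def by blast
    hence "card (Y \<union> P) \<le> M" using True card_mono[of "{S\<in>k_sets n r. all_edges S \<subseteq> R}" "Y \<union> P"] by simp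
    hence "card Y \<le> M - k" using card_factor_edges[OF P n] Y by (simp add: card_Un_disjoint)
    hence "(1 - x) ^ (M - k) \<le> (1 - x) ^ card Y" using x by (intro power_decreasing) auto
    also have "\<dots> = h P R"
    proof -
      have "h P R = (\<Prod>S\<in>I P. if residual P S \<subseteq> R then 1 - x else 1)"
        unfolding h_def by (intro prod.cong) auto
      also have "\<dots> = (1 - x) ^ card Y" using fI[OF P] by (simp add: prod.If_cases Y_def Int_def)
      finally show ?thesis ..
    qed
    finally show ?thesis using True x by (simp add: field_simps)
  next
    case False
    thus ?thesis using h0 x by auto
  qed
  have Eh: "rs_exp ?E p (\<lambda>R. of_bool (edges_of P \<subseteq> R) * h P R) \<le> (p ^ (r choose 2)) ^ k * exp B"
    if P: "P \<in> ?F" for P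
  proof -
    have "h P (R \<union> edges_of P) = h P R" for R
      unfolding h_def by (intro prod.cong) (auto simp: residual_def)
    hence "rs_exp ?E p (\<lambda>R. of_bool (edges_of P \<subseteq> R) * h P R) = p ^ card (edges_of P) * rs_exp ?E p (h P)"
      using rs_exp_superset[of ?E "edges_of P" p "h P"] edges_of_subset[OF P] p by simp
    also have "p ^ card (edges_of P) = (p ^ (r choose 2)) ^ k"
      using card_factor_edges[OF P n] by (simp add: power_mult[symmetric] mult.commute)
    also have "rs_exp ?E p (h P) \<le> exp (- x * (\<Sum>S\<in>I P. p ^ card (residual P S)) + x\<^sup>2 * residual_pairs p P (I P))"
    proof -
      have "residual P S \<subseteq> ?E" if "S \<in> I P" for S
      proof -
        have "S \<subseteq> {..<n}" using that I[OF P] by (auto simp: k_sets_def)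
        thus ?thesis using all_edges_mono unfolding residual_def by blast
      qed
      thus ?thesis unfolding h_def residual_pairs_def
        using x p fI[OF P] by (intro Janson_product) auto
    qed
    also have "\<dots> \<le> exp B" using B[OF P] by simp
    finally show ?thesis using p by (simp add: mult_left_mono)
  qed
  have "rs_exp ?E p (\<lambda>R. real (num_clique_factors r {..<n} R) *
      of_bool (card {S\<in>k_sets n r. all_edges S \<subseteq> R} \<le> M)) \<le>
     rs_exp ?E p (\<lambda>R. \<Sum>P\<in>?F. of_bool (edges_of P \<subseteq> R) * h P R / (1 - x) ^ (M - k))"
  proof (rule rs_exp_mono)
    fix R
    have "real (num_clique_factors r {..<n} R) * of_bool (card {S\<in>k_sets n r. all_edges S \<subseteq> R} \<le> M) =
      (\<Sum>P\<in>?F. of_bool (edges_of P \<subseteq> R) * of_bool (card {S\<in>k_sets n r. all_edges S \<subseteq> R} \<le> M))"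
      by (simp add: num_clique_factors_eq sum_distrib_right[symmetric] Int_def)
    also have "\<dots> \<le> (\<Sum>P\<in>?F. of_bool (edges_of P \<subseteq> R) * h P R / (1 - x) ^ (M - k))"
      by (intro sum_mono pw)
    finally show "real (num_clique_factors r {..<n} R) * of_bool (card {S\<in>k_sets n r. all_edges S \<subseteq> R} \<le> M) \<le>
       (\<Sum>P\<in>?F. of_bool (edges_of P \<subseteq> R) * h P R / (1 - x) ^ (M - k))" .
  qed simp
  also have "\<dots> = (\<Sum>P\<in>?F. rs_exp ?E p (\<lambda>R. of_bool (edges_of P \<subseteq> R) * h P R) / (1 - x) ^ (M - k))"
    by (subst Bochner_Integration.integral_sum) auto
  also have "\<dots> \<le> (\<Sum>P\<in>?F. (p ^ (r choose 2)) ^ k * exp B / (1 - x) ^ (M - k))"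
    using x by (intro sum_mono divide_right_mono Eh) auto
  finally show ?thesis by simp
qed

lemma factor_moment:
  assumes n: "n = r * k" "r > 0" and p: "0 \<le> p" "p \<le> 1"
  shows "rs_exp (all_edges {..<n}) p (\<lambda>R. real (num_clique_factors r {..<n} R)) =
    real (card (factors {..<n} r)) * (p ^ (r choose 2)) ^ k"
proof -
  let ?E = "all_edges {..<n}" and ?F = "factors {..<n} r"
  have "rs_exp ?E p (\<lambda>R. real (num_clique_factors r {..<n} R)) =
     rs_exp ?E p (\<lambda>R. \<Sum>P\<in>?F. of_bool (edges_of P \<subseteq> R))"
    by (simp add: num_clique_factors_eq Int_def)
  also have "\<dots> = (\<Sum>P\<in>?F. rs_exp ?E p (\<lambda>R. of_bool (edges_of P \<subseteq> R)))"
    by (rule Bochner_Integration.integral_sum) simp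
  also have "\<dots> = (\<Sum>P\<in>?F. (p ^ (r choose 2)) ^ k)"
  proof (intro sum.cong refl)
    fix P assume P: "P \<in> ?F"
    show "rs_exp ?E p (\<lambda>R. of_bool (edges_of P \<subseteq> R)) = (p ^ (r choose 2)) ^ k"
      using edges_of_subset[OF P] card_factor_edges[OF P n] p
      by (simp add: rs_exp_superset_prob power_mult[symmetric] mult.commute)
  qed
  finally show ?thesis by simp
qed

section \<open>Factorials and falling factorials\<close>

lemma falling_fact_fact: "k \<le> m \<Longrightarrow> falling_fact (real m) k * fact (m - k) = fact m"
proof (induction k)
  case (Suc k)
  have "fact (m - k) = real (m - k) * fact (m - Suc k)"
    using Suc.prems fact_reduce[of "m - k", where ?'a = real] by simp
  thus ?case using Suc by (simp add: falling_fact_def of_nat_diff)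
qed (simp add: falling_fact_def)

lemma falling_fact_nonneg: "0 \<le> falling_fact (real m) k"
proof (cases "k \<le> m")
  case True
  thus ?thesis unfolding falling_fact_def by (intro prod_nonneg) auto
next
  case False
  hence "falling_fact (real m) k = 0" unfolding falling_fact_def by (intro prod_zero) auto
  thus ?thesis by simp
qed

lemma falling_fact_pos: "k \<le> m \<Longrightarrow> 0 < falling_fact (real m) k"
  unfolding falling_fact_def by (intro prod_pos) auto

lemma falling_fact_le_power: "k \<le> m \<Longrightarrow> falling_fact (real m) k \<le> real m ^ k"
  unfolding falling_fact_def
  using prod_mono[of "{..<k}" "\<lambda>i. real m - real i" "\<lambda>_. real m"] by simp

lemma power_Suc_le_exp: "real (Suc j) ^ j \<le> exp 1 * real j ^ j"
proof (cases "j = 0")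
  case False
  have "(1 + 1 / real j) ^ j \<le> exp (1 / real j) ^ j"
    by (intro power_mono exp_ge_add_one_self) auto
  also have "\<dots> = exp 1" using False by (simp add: exp_of_nat_mult[symmetric])
  finally have "(1 + 1 / real j) ^ j * real j ^ j \<le> exp 1 * real j ^ j" by (intro mult_right_mono) auto
  moreover have "(1 + 1 / real j) ^ j * real j ^ j = real (Suc j) ^ j"
    using False by (simp add: power_mult_distrib[symmetric] field_simps)
  ultimately show ?thesis by simp
qed auto

text \<open>Consecutive terms have the ratio e / (1 + 1/j)^j, which is at least 1. This monotonicity
  stands in for Stirling's formula.\<close>

lemma mono_fact_exp_over_power: "mono (\<lambda>j. fact j * exp (real j) / real j ^ j)"
proof (rule incseq_SucI)
  fix j :: nat
  have "fact j * exp (real j) * real (Suc j) ^ j \<le> fact j * exp (real j) * (exp 1 * real j ^ j)"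
    by (intro mult_left_mono power_Suc_le_exp) auto
  hence *: "fact j * exp (real j) * real (Suc j) ^ Suc j \<le> fact (Suc j) * exp (real (Suc j)) * real j ^ j"
    using mult_left_mono[of "fact j * exp (real j) * real (Suc j) ^ j" "fact j * exp (real j) * (exp 1 * real j ^ j)" "real (Suc j)"]
    by (simp add: exp_add mult_ac)
  have pos: "0 < real j ^ j" "0 < real (Suc j) ^ Suc j" by (cases "j = 0") auto
  show "fact j * exp (real j) / real j ^ j \<le> fact (Suc j) * exp (real (Suc j)) / real (Suc j) ^ Suc j"
    by (rule mult_imp_div_pos_le[OF pos(1)], unfold times_divide_eq_left, rule mult_imp_le_div_pos[OF pos(2)], rule *)
qed

text \<open>The ratio of \<open>mono_fact_exp_over_power\<close> at m - k is at most the one at m.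
  Cancelling (m-k)! and e^m leaves the claim.\<close>

lemma falling_fact_lower:
  assumes "k < m"
  shows "real m ^ k * exp (- real k) \<le> falling_fact (real m) k * (1 - real k / real m) ^ (m - k)"
proof -
  let ?d = "m - k"
  have d: "real ?d > 0" "real m > 0" using assms by auto
  have "fact ?d * exp (real ?d) / real ?d ^ ?d \<le> fact m * exp (real m) / real m ^ m"
    using monoD[OF mono_fact_exp_over_power, of ?d m] by simp
  also have "fact m = falling_fact (real m) k * fact ?d" using falling_fact_fact[of k m] assms by simp
  finally have "fact ?d * (exp (real ?d) * real m ^ m) \<le> fact ?d * (falling_fact (real m) k * exp (real m) * real ?d ^ ?d)"
    using d by (simp add: field_simps)
  hence *: "exp (real ?d) * real m ^ m \<le> falling_fact (real m) k * exp (real m) * real ?d ^ ?d"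
    by (simp only: mult_le_cancel_left_pos[OF fact_gt_zero])
  have e1: "1 - real k / real m = real ?d / real m" using assms d by (simp add: of_nat_diff field_simps)
  have e2: "real m ^ m = real m ^ k * real m ^ ?d" using assms by (simp add: power_add[symmetric])
  have e3: "exp (real ?d) = exp (- real k) * exp (real m)"
    using assms by (simp add: exp_add[symmetric] of_nat_diff)
  have "exp (real m) * (exp (- real k) * (real m ^ k * real m ^ ?d)) \<le> exp (real m) * (falling_fact (real m) k * real ?d ^ ?d)"
    using * unfolding e2 e3 by (simp only: mult_ac)
  hence "exp (- real k) * (real m ^ k * real m ^ ?d) \<le> falling_fact (real m) k * real ?d ^ ?d"
    by (simp only: mult_le_cancel_left_pos[OF exp_gt_zero])
  thus ?thesis unfolding e1 power_divide using d by (simp add: field_simps)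
qed

lemma binomial_lower: "real (r * k) ^ r \<le> real r ^ r * real ((r * k) choose r)" if "r > 0" "k > 0"
proof -
  have "(real (r * k) / real r) ^ r \<le> real ((r * k) choose r)"
    using that by (intro binomial_ge_n_over_k_pow_k) auto
  thus ?thesis using that by (simp add: power_divide field_simps)
qed

text \<open>Guarantees that the denominator (N)_k of \<open>Sigma_factors\<close> is
  positive.\<close>

lemma le_binomial: "r > 0 \<Longrightarrow> k \<le> (r * k) choose r"
proof (cases "k = 0")
  case False
  assume r: "r > 0"
  have "real k \<le> real k ^ r" using False r by (intro self_le_power) auto
  also have "\<dots> = (real (r * k) / real r) ^ r" using r by simp
  also have "\<dots> \<le> real ((r * k) choose r)"
    using False r by (intro binomial_ge_n_over_k_pow_k) auto
  finally show ?thesis by simp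
qed auto

lemma Sigma_factors_nonneg:
  assumes "r > 0" "n = r * k"
  shows "0 \<le> Sigma_factors r n m"
  unfolding Sigma_factors_def using falling_fact_nonneg by simp

lemma card_factors_real_le:
  assumes "n = r * k" "r > 0"
  shows "real (card (factors {..<n} r)) \<le> fact n / (fact r ^ k * fact k)"
proof -
  have "real (card (factors {..<n} r) * (fact r ^ k * fact k)) \<le> real (fact n)"
    using card_factors_le[of "{..<n}" r k] assms by (intro of_nat_mono) simp
  thus ?thesis by (simp add: field_simps)
qed

lemma fact_times_prod: "fact m * (\<Prod>i<r. real (m + r - i)) = fact (m + r)"
proof (induction r)
  case (Suc r)
  have "(\<Prod>i<Suc r. real (m + Suc r - i)) = real (m + Suc r) * (\<Prod>i<r. real (m + r - i))"
    by (subst prod.lessThan_Suc_shift) simp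
  hence "fact m * (\<Prod>i<Suc r. real (m + Suc r - i)) = real (m + Suc r) * (fact m * (\<Prod>i<r. real (m + r - i)))"
    by (simp only: mult_ac)
  also have "\<dots> = fact (m + Suc r)" unfolding Suc by simp
  finally show ?case .
qed auto

lemma fact_mult_eq_prod: "fact (r * k) = (\<Prod>j<k. \<Prod>i<r. real (r * Suc j - i))"
proof (induction k)
  case (Suc k)
  have "fact (r * Suc k) = fact (r * k) * (\<Prod>i<r. real (r * k + r - i))"
    unfolding fact_times_prod by (simp add: add.commute)
  thus ?case unfolding prod.lessThan_Suc Suc[symmetric] by (simp only: mult_Suc_right add.commute)
qed auto

text \<open>Compares the factor of \<open>fact n\<close> belonging to the $j$-th block with a $(j/k)^r$-fraction of
  the falling factorial of \<open>n\<close> of length \<open>r\<close>.\<close>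

lemma fact_mult_power_le:
  "fact (r * k) * real k ^ (r * k) \<le> (fact r * real ((r * k) choose r)) ^ k * fact k ^ r"
proof (cases "k = 0")
  case False
  let ?n = "r * k"
  have n: "r \<le> ?n" using False by simp
  have N: "fact r * real (?n choose r) = (\<Prod>i<r. real (?n - i))"
  proof -
    have "fact (?n - r) * (\<Prod>i<r. real (?n - i)) = fact ?n"
      using fact_times_prod[of "?n - r" r] unfolding le_add_diff_inverse2[OF n] .
    also have "\<dots> = fact (?n - r) * (fact r * real (?n choose r))"
      using binomial_fact_lemma[OF n] by (metis (mono_tags, lifting) mult.commute mult.left_commute of_nat_fact of_nat_mult)
    finally show ?thesis by simp
  qed
  have "fact ?n * real k ^ ?n = (\<Prod>j<k. \<Prod>i<r. real (r * Suc j - i) * real k)"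
    by (simp add: fact_mult_eq_prod prod.distrib power_mult)
  also have "\<dots> \<le> (\<Prod>j<k. \<Prod>i<r. real (?n - i) * real (Suc j))"
  proof (intro prod_mono conjI prod_nonneg ballI)
    fix j i assume ij: "j \<in> {..<k}" "i \<in> {..<r}"
    have "i * Suc j \<le> i * k" using ij by (intro mult_left_mono) auto
    hence "(r * Suc j - i) * k \<le> (?n - i) * Suc j"
      by (simp add: diff_mult_distrib algebra_simps)
    thus "real (r * Suc j - i) * real k \<le> real (?n - i) * real (Suc j)"
      by (simp only: of_nat_mult[symmetric] of_nat_le_iff)
  qed (rule mult_nonneg_nonneg of_nat_0_le_iff)+
  also have "\<dots> = (\<Prod>j<k. (fact r * real (?n choose r)) * real (Suc j) ^ r)"
    unfolding N by (simp add: prod.distrib)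
  also have "\<dots> = (fact r * real (?n choose r)) ^ k * (\<Prod>j<k. real (Suc j)) ^ r"
    by (simp only: prod.distrib prod_power_distrib prod_constant card_lessThan power_mult_distrib)
  also have "(\<Prod>j<k. real (Suc j)) = fact k"
    by (induction k) (simp_all add: algebra_simps)
  finally show ?thesis .
qed auto

text \<open>This is k! \<le> ((k+1)/2)^k, which also follows from the inequality of arithmetic and
  geometric means; the induction step amounts to (1 + 1/(k+1))^(k+1) \<ge> 2.\<close>

lemma fact_two_power_le: "fact k * 2 ^ k \<le> real (Suc k) ^ k"
proof (induction k)
  case (Suc k)
  have "fact (Suc k) * 2 ^ Suc k = 2 * real (Suc k) * (fact k * 2 ^ k :: real)" by simp
  also have "\<dots> \<le> 2 * real (Suc k) * real (Suc k) ^ k" by (intro mult_left_mono Suc) auto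
  also have "\<dots> = 2 * real (Suc k) ^ Suc k" by simp
  also have "\<dots> \<le> real (Suc (Suc k)) ^ Suc k"
  proof -
    have "2 \<le> 1 + real (Suc k) * (1 / real (Suc k))" by simp
    also have "\<dots> \<le> (1 + 1 / real (Suc k)) ^ Suc k"
      by (rule Bernoulli_inequality) (auto intro: order.trans[of _ 0])
    finally have "2 * real (Suc k) ^ Suc k \<le> (1 + 1 / real (Suc k)) ^ Suc k * real (Suc k) ^ Suc k"
      by (intro mult_right_mono) auto
    also have "\<dots> = ((1 + 1 / real (Suc k)) * real (Suc k)) ^ Suc k" by (rule power_mult_distrib[symmetric])
    also have "(1 + 1 / real (Suc k)) * real (Suc k) = real (Suc (Suc k))" by (simp add: field_simps)
    finally show ?thesis .
  qed
  finally show ?case .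
qed auto

text \<open>With u = k!/k^k, \<open>fact_mult_power_le\<close> reduces the expectation to 3^k
  u^(r-1). Since u \<le> e / 2^k and r - 1 \<ge> 2, this is at most e^2 (3/4)^k. The threshold 3k
  comes from here: a constant below 4 makes this bound decay, and one above 1 keeps x = k/m away
  from 1 in the other case.\<close>

lemma sparse_factor_moment:
  assumes n: "n = r * k" "k > 0" and r: "r \<ge> 3" and q: "0 \<le> q" "real (n choose r) * q \<le> 3 * real k"
  shows "real (card (factors {..<n} r)) * q ^ k \<le> (exp 1)\<^sup>2 * (3 / 4) ^ k"
proof -
  let ?N = "real (n choose r)"
  define u :: real where "u = fact k / real k ^ k"
  have kk: "real k ^ k > 0" using n by simp
  have u0: "0 < u" using kk by (simp add: u_def)
  have "fact k * 2 ^ k \<le> exp 1 * real k ^ k"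
    using fact_two_power_le[of k] power_Suc_le_exp[of k] by linarith
  hence u2: "u \<le> exp 1 / 2 ^ k" using kk by (simp add: u_def field_simps)
  have u1: "u \<le> 1" using kk fact_le_power[where ?'a = real, of k] by (simp add: u_def field_simps)
  have "?N ^ k * q ^ k = (?N * q) ^ k" by (simp add: power_mult_distrib)
  also have "\<dots> \<le> (3 * real k) ^ k" using q by (intro power_mono) auto
  finally have Nq: "?N ^ k * q ^ k \<le> 3 ^ k * real k ^ k" by (simp add: power_mult_distrib)
  have "fact n * real k ^ n \<le> (fact r * ?N) ^ k * fact k ^ r"
    using fact_mult_power_le[of r k] n by simp
  hence "fact n \<le> fact r ^ k * ?N ^ k * (fact k ^ r / real k ^ n)"
    using n by (simp add: power_mult_distrib field_simps)
  also have "fact k ^ r / real k ^ n = u ^ r"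
    unfolding u_def n(1) power_divide by (simp add: power_mult[symmetric] mult.commute)
  finally have fn: "fact n \<le> fact r ^ k * ?N ^ k * u ^ r" .
  have "real (card (factors {..<n} r)) * q ^ k \<le> fact n / (fact r ^ k * fact k) * q ^ k"
    using card_factors_real_le[OF n(1)] q r by (intro mult_right_mono) auto
  also have "\<dots> \<le> fact r ^ k * ?N ^ k * u ^ r / (fact r ^ k * fact k) * q ^ k"
    using fn q by (intro mult_right_mono divide_right_mono) auto
  also have "\<dots> = (?N ^ k * q ^ k) * (u ^ r / fact k)" by (simp add: field_simps)
  also have "\<dots> \<le> (3 ^ k * real k ^ k) * (u ^ r / fact k)"
    using Nq u0 by (intro mult_right_mono) auto
  also have "\<dots> = 3 ^ k * (u ^ r / u)" by (simp add: u_def)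
  also have "u ^ r / u = u ^ (r - 1)" using u0 r by (simp add: power_eq_if)
  also have "\<dots> \<le> u ^ 2" using u0 u1 r by (intro power_decreasing) auto
  also have "\<dots> \<le> (exp 1 / 2 ^ k) ^ 2" using u0 u2 by (intro power_mono) auto
  also have "3 ^ k * (exp 1 / 2 ^ k) ^ 2 = (exp 1)\<^sup>2 * (3 / 4 :: real) ^ k"
    by (simp add: power_divide power_mult[symmetric] mult.commute[of k 2] power_mult)
  finally show ?thesis by simp
qed

text \<open>The exponent m + t - k splits into m - k, which \<open>falling_fact_lower\<close>
  absorbs, and t, which costs exp(O(sqrt n ln n)). The extra factor n on the left side is there to
  give Markov's inequality a failure probability of 1/n.\<close>

lemma Sigma_comparison:
  assumes n: "n = r * k" "r \<ge> 3" "n \<ge> 3" and q: "0 \<le> q"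
    and m: "m = nat \<lfloor>real (n choose r) * q\<rfloor>" "3 * k \<le> m"
    and t: "real t \<le> sqrt (real (n choose r) * q) * ln (real n) + 1"
    and B: "B \<le> - (real k / real m) * (real (n choose r) * q) + c * sqrt (real n)" and c: "0 \<le> c"
  shows "real n * (real (card (factors {..<n} r)) * q ^ k * exp B / (1 - real k / real m) ^ (m + t - k))
    \<le> exp ((c + 5) * sqrt (real n) * ln (real n)) * Sigma_factors r n m"
proof -
  let ?N = "real (n choose r)" and ?x = "real k / real m"
  define \<mu> where "\<mu> = ?N * q"
  have k: "k > 0" using n by (cases "k = 0") auto
  have m0: "m > 0" "k < m" using m(2) k by auto
  have \<mu>0: "0 \<le> \<mu>" using q by (simp add: \<mu>_def)
  have \<mu>m: "real m \<le> \<mu>" "\<mu> \<le> real m + 1"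
    using m(1) \<mu>0 unfolding \<mu>_def[symmetric] by linarith+
  have x: "0 < ?x" "?x \<le> 1 / 3" using k m m0 by (auto simp: field_simps)
  have L: "1 \<le> ln (real n)"
  proof -
    have "exp 1 \<le> real n" using n(3) exp_le by linarith
    thus ?thesis using n(3) by (subst ln_ge_iff) auto
  qed
  have sn: "1 \<le> sqrt (real n)" using n(3) by simp
  \<comment> \<open>One origin of the sqrt n in the theorem: the square of x sqrt(\<mu>) is at most
    2 x^2 m = 2 k x, which is at most k because x \<le> 1/3.\<close>
  have xt: "?x * real t \<le> sqrt (real n) * ln (real n) + 1"
  proof -
    have "(?x * sqrt \<mu>)\<^sup>2 = ?x\<^sup>2 * \<mu>" unfolding power_mult_distrib using \<mu>0 by simp
    also have "\<dots> \<le> ?x\<^sup>2 * (2 * real m)" using \<mu>m m0 by (intro mult_left_mono) auto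
    also have "\<dots> = 2 * real k * ?x" using m0 by (simp add: power2_eq_square field_simps)
    also have "\<dots> \<le> 2 * real k * (1 / 3)" using x by (intro mult_left_mono) auto
    also have "\<dots> \<le> real k" by simp
    also have "\<dots> \<le> real n" unfolding n(1) using n(2) by (intro of_nat_mono) simp
    finally have "?x * sqrt \<mu> \<le> sqrt (real n)" by (rule real_le_rsqrt)
    hence "?x * sqrt \<mu> * ln (real n) \<le> sqrt (real n) * ln (real n)" using L by (intro mult_right_mono) auto
    moreover have "?x * real t \<le> ?x * (sqrt \<mu> * ln (real n) + 1)"
      using t x unfolding \<mu>_def by (intro mult_left_mono) auto
    moreover have "?x * (sqrt \<mu> * ln (real n) + 1) = ?x * sqrt \<mu> * ln (real n) + ?x"
      by (simp only: distrib_left mult_1_right mult.assoc)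
    ultimately show ?thesis using x by linarith
  qed
  have y0: "0 < 1 - ?x" using x by linarith
  have inv: "1 / (1 - ?x) ^ t \<le> exp (3 / 2 * (?x * real t))"
  proof -
    have "1 / (1 - a) = 1 + a / (1 - a)" if "0 < 1 - a" for a :: real
      using that by (simp add: field_simps)
    from this[OF y0] have "1 / (1 - ?x) = 1 + ?x / (1 - ?x)" .
    also have "\<dots> \<le> exp (?x / (1 - ?x))" by (rule exp_ge_add_one_self)
    also have "?x / (1 - ?x) \<le> 3 / 2 * ?x"
    proof -
      have "1 \<le> 3 / 2 * (1 - a)" if "a \<le> 1 / 3" for a :: real using that by argo
      from this[OF x(2)] have "?x * 1 \<le> ?x * (3 / 2 * (1 - ?x))"
        by (rule mult_left_mono) (rule less_imp_le[OF x(1)])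
      thus ?thesis unfolding pos_divide_le_eq[OF y0] by (simp only: mult_ac mult_1_right)
    qed
    finally have "1 / (1 - ?x) \<le> exp (3 / 2 * ?x)" by simp
    hence "(1 / (1 - ?x)) ^ t \<le> exp (3 / 2 * ?x) ^ t" using y0 by (intro power_mono) auto
    thus ?thesis by (simp add: power_one_over exp_of_nat_mult[symmetric] mult_ac)
  qed
  \<comment> \<open>Rounding \<mu> down to m costs at most a factor e, because k \<le> m.\<close>
  have \<mu>k: "\<mu> ^ k \<le> exp 1 * real m ^ k"
  proof -
    have "\<mu> ^ k \<le> (real m + 1) ^ k" using \<mu>m \<mu>0 by (intro power_mono) auto
    also have "\<dots> = (1 + 1 / real m) ^ k * real m ^ k"
      using m0 by (simp add: power_mult_distrib[symmetric] field_simps)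
    also have "(1 + 1 / real m) ^ k \<le> exp (1 / real m) ^ k"
      by (intro power_mono exp_ge_add_one_self) auto
    also have "\<dots> = exp ?x" by (simp add: exp_of_nat_mult[symmetric])
    also have "\<dots> \<le> exp 1" unfolding exp_le_cancel_iff using x by linarith
    finally show ?thesis by (simp add: mult_right_mono)
  qed
  have xm: "real k \<le> ?x * \<mu>"
  proof -
    have "?x * real m \<le> ?x * \<mu>" using \<mu>m x by (intro mult_left_mono) auto
    thus ?thesis using m0 by simp
  qed
  have eB: "exp B \<le> exp (- real k) * exp (c * sqrt (real n))"
  proof -
    have "B \<le> - real k + c * sqrt (real n)" using B xm unfolding \<mu>_def by simp
    thus ?thesis by (simp add: exp_add[symmetric])
  qed
  have kN: "k \<le> n choose r" using le_binomial[of r k] n by simp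
  let ?T = "fact n / (fact r ^ k * fact k) :: real" and ?f = "falling_fact (real m) k"
  have main: "real n * (q ^ k * exp B / (1 - ?x) ^ (m + t - k)) * ?N ^ k \<le>
      exp ((c + 5) * sqrt (real n) * ln (real n)) * ?f"
  proof -
    have "real n * (q ^ k * exp B / (1 - ?x) ^ (m + t - k)) * ?N ^ k =
      real n * (\<mu> ^ k * exp B) * (1 / (1 - ?x) ^ (m - k)) * (1 / (1 - ?x) ^ t)"
    proof -
      have "m + t - k = (m - k) + t" using m0 by simp
      thus ?thesis by (simp add: power_add \<mu>_def power_mult_distrib)
    qed
    also have "\<dots> \<le> real n * ((exp 1 * real m ^ k) * (exp (- real k) * exp (c * sqrt (real n)))) *
        (1 / (1 - ?x) ^ (m - k)) * exp (3 / 2 * (?x * real t))"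
      using y0 \<mu>0 by (intro mult_mono \<mu>k eB inv order.refl mult_nonneg_nonneg) auto
    also have "\<dots> = real n * exp 1 * exp (c * sqrt (real n)) * exp (3 / 2 * (?x * real t)) *
       ((real m ^ k * exp (- real k)) / (1 - ?x) ^ (m - k))" by simp
    also have "\<dots> \<le> real n * exp 1 * exp (c * sqrt (real n)) * exp (3 / 2 * (?x * real t)) * ?f"
    proof (intro mult_left_mono)
      show "real m ^ k * exp (- real k) / (1 - ?x) ^ (m - k) \<le> ?f"
        using falling_fact_lower[OF m0(2)] y0 by (simp add: pos_divide_le_eq)
    qed auto
    also have "real n * exp 1 * exp (c * sqrt (real n)) * exp (3 / 2 * (?x * real t)) =
       exp (ln (real n) + 1 + c * sqrt (real n) + 3 / 2 * (?x * real t))"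
      using n(3) by (simp add: exp_add)
    also have "\<dots> * ?f \<le> exp ((c + 5) * sqrt (real n) * ln (real n)) * ?f"
    proof (intro mult_right_mono falling_fact_nonneg)
      \<comment> \<open>The constant 5: ln n and 1 cost one \<open>?s\<close> each, and the last
        summand is at most 3/2 (\<open>?s\<close> + 1), hence at most 3 \<open>?s\<close>.\<close>
      let ?s = "sqrt (real n) * ln (real n)"
      have "1 * ln (real n) \<le> ?s" using L by (intro mult_right_mono sn) linarith
      hence "ln (real n) \<le> ?s" by (simp only: mult_1)
      moreover have "1 \<le> ?s" using calculation L by linarith
      moreover have "c * sqrt (real n) \<le> c * ?s"
        using mult_left_mono[OF L, of "sqrt (real n)"] c by (intro mult_left_mono) auto
      ultimately have "ln (real n) + 1 + c * sqrt (real n) + 3 / 2 * (?x * real t) \<le> (c + 5) * ?s"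
        using xt by (simp add: algebra_simps)
      thus "exp (ln (real n) + 1 + c * sqrt (real n) + 3 / 2 * (?x * real t)) \<le> exp ((c + 5) * sqrt (real n) * ln (real n))"
        by (simp add: mult.assoc)
    qed
    finally show ?thesis .
  qed
  have F0: "0 < falling_fact ?N k" and FN: "falling_fact ?N k \<le> ?N ^ k"
    using falling_fact_pos[OF kN] falling_fact_le_power[OF kN] .
  let ?Z = "q ^ k * exp B / (1 - ?x) ^ (m + t - k)"
  have Z0: "0 \<le> ?Z" using q y0 by simp
  have "real n * ?Z * falling_fact ?N k \<le> real n * ?Z * ?N ^ k"
    by (intro mult_left_mono FN mult_nonneg_nonneg Z0) simp
  with main have "real n * ?Z * falling_fact ?N k \<le> exp ((c + 5) * sqrt (real n) * ln (real n)) * ?f" by linarith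
  hence nZ: "real n * ?Z \<le> exp ((c + 5) * sqrt (real n) * ln (real n)) * (?f / falling_fact ?N k)"
    using F0 by (simp add: pos_le_divide_eq)
  have "real n * (real (card (factors {..<n} r)) * q ^ k * exp B / (1 - ?x) ^ (m + t - k)) =
     real (card (factors {..<n} r)) * (real n * ?Z)" by simp
  also have "\<dots> \<le> ?T * (real n * ?Z)"
    using card_factors_real_le[OF n(1)] n(2) by (intro mult_right_mono mult_nonneg_nonneg Z0) auto
  also have "\<dots> \<le> ?T * (exp ((c + 5) * sqrt (real n) * ln (real n)) * (?f / falling_fact ?N k))"
    by (intro mult_left_mono nZ) auto
  also have "\<dots> = exp ((c + 5) * sqrt (real n) * ln (real n)) * Sigma_factors r n m"
  proof -
    have "n div r = k" using n(1,2) by simp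
    thus ?thesis by (simp add: Sigma_factors_def)
  qed
  finally show ?thesis .
qed

section \<open>Exponents of overlapping cliques\<close>

lemma real_choose_two: "real (s choose 2) = real s * (real s - 1) / 2"
proof -
  have "even (s * (s - 1))" by (cases s) auto
  hence "2 * (s choose 2) = s * (s - 1)" unfolding choose_two by (rule dvd_mult_div_cancel)
  hence "2 * real (s choose 2) = real s * real (s - 1)" by (metis of_nat_mult of_nat_numeral)
  thus ?thesis by (cases "s = 0") (auto simp: of_nat_diff)
qed

text \<open>The difference between (s-1)(r-s) and its value r - 2 at s = 2 and s = r - 1 is
  (s-2)(r-1-s). At p = n^(-2/r) the expected number of s-cliques has order n^(1 + (s-1)(r-s)/r); the
  left side is 2 minus this exponent.\<close>

lemma overlap_exponent:
  fixes r s :: real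
  assumes "2 \<le> s" "s \<le> r - 1" "r > 0"
  shows "1 - (s - 1) * (r - s) / r \<le> 2 / r"
proof -
  have "0 \<le> (s - 2) * (r - 1 - s)" using assms by (intro mult_nonneg_nonneg) auto
  hence "r - 2 \<le> (s - 1) * (r - s)" by (simp add: algebra_simps)
  hence "(r - 2) / r \<le> (s - 1) * (r - s) / r" using assms(3) by (intro divide_right_mono) auto
  thus ?thesis using assms(3) by (simp add: diff_divide_distrib)
qed

text \<open>This is where the exponent \<open>\<gamma>\<close> comes from: the expected number of \<open>r\<close>-cliques that extend a
  given \<open>s\<close>-clique stays bounded.\<close>

lemma overlap_density_le_1:
  fixes p :: real
  assumes r: "r \<ge> 3" and s: "s \<in> {2..<r}" and n: "n > 0"
    and p: "0 \<le> p" "p \<le> real n powr (- 2 / real r + (real r - 2) / (real r * real (r choose 2)))"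
  shows "real n ^ (r - s) * p ^ ((r choose 2) - (s choose 2)) \<le> 1"
proof -
  let ?K = "real (r choose 2)" and ?c = "real (s choose 2)"
  define g where "g = (real r - 2) / (real r * ?K)"
  have cK: "s choose 2 \<le> r choose 2" using s by (intro binomial_two_mono) auto
  have K: "?K > 0" using r by simp
  have g: "0 \<le> g" "?K * g = (real r - 2) / real r" using r K by (auto simp: g_def)
  let ?d = "(r choose 2) - (s choose 2)"
  have d: "real ?d = ?K - ?c" using cK by (simp add: of_nat_diff)
  have "real n ^ (r - s) * p ^ ?d \<le> real n ^ (r - s) * (real n powr (- 2 / real r + g)) ^ ?d"
    using p unfolding g_def by (intro mult_left_mono power_mono) auto
  also have "\<dots> = real n powr (real (r - s) + (- 2 / real r + g) * real ?d)"
    using n by (simp add: powr_add powr_realpow[symmetric] powr_powr)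
  also have "\<dots> \<le> real n powr 0"
  proof (intro powr_mono)
    \<comment> \<open>At p = n^(-2/r) the exponent of n is -(s-1)(r-s)/r, at most -(r-2)/r. Each of
      the at most (r choose 2) edges adds g, and (r choose 2) g = (r-2)/r is precisely this
      margin.\<close>
    have "(- 2 / real r + g) * (?K - ?c) = - 2 / real r * ?K + 2 / real r * ?c + g * ?K - g * ?c"
      by (simp add: algebra_simps)
    also have "\<dots> \<le> - 2 / real r * ?K + 2 / real r * ?c + (real r - 2) / real r"
      using g by (simp add: mult.commute)
    also have "- 2 / real r * ?K = - (real r - 1)" using r by (simp add: real_choose_two)
    also have "2 / real r * ?c = real s * (real s - 1) / real r" by (simp add: real_choose_two)
    finally have "real (r - s) + (- 2 / real r + g) * (?K - ?c) \<le>
      real r - real s - (real r - 1) + real s * (real s - 1) / real r + (real r - 2) / real r"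
      using s by (simp add: of_nat_diff)
    also have "\<dots> = (1 - (real s - 1) * (real r - real s) / real r) - 2 / real r"
      using r by (simp add: field_simps)
    also have "\<dots> \<le> 0"
    proof -
      have "real s \<le> real r - 1" using s by auto
      thus ?thesis using overlap_exponent[of "real s" "real r"] s by auto
    qed
    finally show "real (r - s) + (- 2 / real r + g) * real ?d \<le> 0" unfolding d .
  qed (use n in auto)
  finally show ?thesis using n by simp
qed

text \<open>The last hypothesis follows from \<mu> \<ge> k and says that p^(r choose 2) \<ge>
  n^(1-r) / r. Raising this to the power (s choose 2) / (r choose 2) \<le> 1 gives n^s p^(s choose
  2) \<ge> n^(2 - 2/r) / r, and 2 - 2/r \<ge> 3/2 for r \<ge> 4.\<close>

lemma overlap_clique_lower:
  fixes p :: real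
  assumes r: "r \<ge> 4" and s: "s \<in> {2..<r}" and n: "n > 0"
    and p: "0 \<le> p" "real n \<le> real r * (real n ^ r * p ^ (r choose 2))"
  shows "(real n)\<^sup>2 \<le> real r * sqrt (real n) * real n ^ s * p ^ (s choose 2)"
proof -
  let ?K = "real (r choose 2)" and ?c = "real (s choose 2)"
  have K: "r choose 2 > 0" "?K > 0" using r by simp_all
  hence p0: "p > 0" using p n by (cases "p = 0") (auto simp: zero_power)
  have cK: "?c \<le> ?K" using s by (intro of_nat_mono binomial_two_mono) auto
  define e where "e = ?c / ?K"
  have e: "0 \<le> e" "e \<le> 1" using cK K by (auto simp: e_def)
  have sr: "real s \<le> real r - 1" using s by auto
  have e': "(real r - 1) * e = real s * (real s - 1) / real r"
    using r by (simp add: e_def real_choose_two field_simps)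
  have "real n powr (1 - real r) / real r \<le> p ^ (r choose 2)"
  proof -
    have "real n powr (1 - real r) = real n / real n ^ r"
      using n by (simp add: powr_diff powr_realpow)
    hence "real n ^ r * real n powr (1 - real r) \<le> real n ^ r * (real r * p ^ (r choose 2))"
      using p(2) n by (simp add: mult_ac)
    hence "real n powr (1 - real r) \<le> real r * p ^ (r choose 2)"
      using n by (simp only: mult_le_cancel_left_pos zero_less_power of_nat_0_less_iff)
    thus ?thesis using r by (simp add: field_simps)
  qed
  hence "(real n powr (1 - real r) / real r) powr e \<le> (p ^ (r choose 2)) powr e"
    using e by (intro powr_mono2) auto
  also have "(p ^ (r choose 2)) powr e = p ^ (s choose 2)"
    using p0 K by (simp add: powr_realpow[symmetric] powr_powr e_def)
  finally have "(real n powr (1 - real r)) powr e / real r powr e \<le> p ^ (s choose 2)"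
    by (simp add: powr_divide)
  moreover have "real r powr e \<le> real r"
    using powr_mono[OF e(2), of "real r"] r by simp
  hence "(real n powr (1 - real r)) powr e / real r \<le> (real n powr (1 - real r)) powr e / real r powr e"
    using r by (intro divide_left_mono) auto
  ultimately have "(real n powr (1 - real r)) powr e / real r \<le> p ^ (s choose 2)" by linarith
  hence low: "real n powr ((1 - real r) * e) \<le> real r * p ^ (s choose 2)"
    using r by (simp only: powr_powr) (simp add: pos_divide_le_eq mult.commute)
  have "(real n)\<^sup>2 = real n powr 2" using n by simp
  also have "\<dots> \<le> real n powr (1 / 2 + real s + (1 - real r) * e)"
  proof (intro powr_mono)
    have "2 / real r \<le> 1 / 2" using r by (simp add: field_simps)
    moreover have "1 - (real s - 1) * (real r - real s) / real r \<le> 2 / real r"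
      using s r by (intro overlap_exponent sr) auto
    ultimately have "1 - (real s - 1) * (real r - real s) / real r \<le> 1 / 2" by linarith
    moreover have "2 - real s + real s * (real s - 1) / real r = 1 - (real s - 1) * (real r - real s) / real r"
      using r by (simp add: field_simps)
    moreover have "(1 - real r) * e = - ((real r - 1) * e)" by (simp add: algebra_simps)
    ultimately show "2 \<le> 1 / 2 + real s + (1 - real r) * e" using e' by linarith
  qed (use n in auto)
  also have "\<dots> = sqrt (real n) * real n ^ s * real n powr ((1 - real r) * e)"
    using n by (simp add: powr_add powr_realpow powr_half_sqrt)
  also have "\<dots> \<le> sqrt (real n) * real n ^ s * (real r * p ^ (s choose 2))"
    by (intro mult_left_mono low) auto
  finally show ?thesis by (simp add: mult_ac)
qed

section \<open>The exponent in Janson's inequality\<close>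

text \<open>Here x \<mu> \<le> 2 k. The copies that use an edge of P are a fraction O(1/n) of all,
  so giving them up costs O(1). The pairs with s common vertices cost O(n^2) divided by n^s p^(s
  choose 2), which is at least of order n^(3/2).\<close>

lemma disjoint_family_exponent:
  assumes n: "n = r * k" "r \<ge> 4" "k > 0" and p: "0 \<le> p" "p \<le> 1"
    and m: "m = nat \<lfloor>real (n choose r) * p ^ (r choose 2)\<rfloor>" "3 * k \<le> m"
    and P: "P \<in> factors {..<n} r"
  defines "x \<equiv> real k / real m" and "I \<equiv> {S \<in> k_sets n r. all_edges S \<inter> edges_of P = {}}"
  shows "- x * (\<Sum>S\<in>I. p ^ card (residual P S)) + x\<^sup>2 * residual_pairs p P I \<le>
    - x * (real (n choose r) * p ^ (r choose 2)) +
    (2 * real (r choose 2) * real r ^ r + 4 * real r ^ Suc r * (\<Sum>s=2..<r. real (r choose s))) * sqrt (real n)"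
proof -
  let ?q = "p ^ (r choose 2)" and ?K = "real (r choose 2)"
  define \<mu> where "\<mu> = real (n choose r) * ?q"
  have r0: "r > 0" using n by simp
  have n0: "n > 0" "1 \<le> n" "k \<le> n" using n by auto
  have m0: "m > 0" using m(2) n(3) by auto
  have q0: "0 \<le> ?q" using p by simp
  have \<mu>0: "0 \<le> \<mu>" using q0 by (simp add: \<mu>_def)
  have \<mu>m: "real m \<le> \<mu>" "\<mu> \<le> 2 * real m"
    using m(1) \<mu>0 m0 unfolding \<mu>_def[symmetric] by linarith+
  have x0: "0 \<le> x" by (simp add: x_def)
  have x\<mu>: "x * \<mu> \<le> 2 * real k"
    using mult_left_mono[OF \<mu>m(2) x0] m0 by (simp add: x_def)
  have nq: "real n ^ r * ?q \<le> real r ^ r * \<mu>"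
    using mult_right_mono[OF binomial_lower[OF r0 n(3)] q0] by (simp add: n(1) \<mu>_def mult_ac)
  have \<mu>nq: "\<mu> \<le> real n ^ r * ?q"
  proof -
    have "real (n choose r) \<le> real (n ^ r)" using binomial_le_power by (intro of_nat_mono)
    thus ?thesis using q0 unfolding \<mu>_def by (intro mult_right_mono) auto
  qed
  have sn: "1 \<le> sqrt (real n)" using n0 by simp
  have kn: "real k \<le> real n" using n0 by simp
  have D: "x\<^sup>2 * \<mu> * (real n ^ (r - s) * p ^ ((r choose 2) - (s choose 2))) \<le> 4 * real r ^ Suc r * sqrt (real n)"
    if s: "s \<in> {2..<r}" for s
  proof -
    let ?D = "real n ^ (r - s) * p ^ ((r choose 2) - (s choose 2))"
    have D0: "0 \<le> ?D" using p by simp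
    have "real n ^ r = real n ^ (r - s) * real n ^ s" using s by (simp add: power_add[symmetric])
    moreover have "?q = p ^ ((r choose 2) - (s choose 2)) * p ^ (s choose 2)"
      using binomial_two_mono[of s r] s by (simp add: power_add[symmetric])
    \<comment> \<open>A lower bound on the expected number of s-cliques thus becomes an upper bound
      on their extensions \<open>?D\<close>.\<close>
    ultimately have split: "?D * (real n ^ s * p ^ (s choose 2)) = real n ^ r * ?q" by (simp only: mult_ac)
    have "real n \<le> real r * \<mu>"
    proof -
      have "real n = real r * real k" using n by simp
      also have "real k \<le> real m" using m(2) by simp
      also have "\<dots> \<le> \<mu>" by (rule \<mu>m)
      finally show ?thesis by (simp add: mult_left_mono)
    qed
    also have "\<dots> \<le> real r * (real n ^ r * ?q)" by (intro mult_left_mono \<mu>nq) auto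
    finally have "(real n)\<^sup>2 \<le> real r * sqrt (real n) * real n ^ s * p ^ (s choose 2)"
      using overlap_clique_lower[OF n(2) s n0(1) p(1)] by simp
    hence "?D * (real n)\<^sup>2 \<le> ?D * (real r * sqrt (real n) * real n ^ s * p ^ (s choose 2))"
      using D0 by (intro mult_left_mono)
    also have "\<dots> = real r * sqrt (real n) * (?D * (real n ^ s * p ^ (s choose 2)))" by (simp only: mult_ac)
    also have "\<dots> \<le> real r * sqrt (real n) * (real r ^ r * \<mu>)"
      unfolding split by (intro mult_left_mono nq) auto
    finally have "x\<^sup>2 * \<mu> * (?D * (real n)\<^sup>2) \<le> x\<^sup>2 * \<mu> * (real r * sqrt (real n) * (real r ^ r * \<mu>))"
      using \<mu>0 by (intro mult_left_mono) auto
    also have "\<dots> = real r ^ Suc r * sqrt (real n) * (x * \<mu>)\<^sup>2" by (simp add: power2_eq_square mult_ac)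
    also have "\<dots> \<le> real r ^ Suc r * sqrt (real n) * (2 * real n)\<^sup>2"
      using x\<mu> x0 \<mu>0 kn by (intro mult_left_mono power_mono) auto
    finally have "x\<^sup>2 * \<mu> * ?D * (real n)\<^sup>2 \<le> (4 * real r ^ Suc r * sqrt (real n)) * (real n)\<^sup>2"
      by (simp add: power_mult_distrib mult_ac)
    thus ?thesis using n0 by (simp only: mult_le_cancel_right_pos zero_less_power of_nat_0_less_iff)
  qed
  note sums = disjoint_family_sums[OF P n(1) r0 p, folded I_def]
  have "x\<^sup>2 * residual_pairs p P I \<le> x\<^sup>2 * (\<mu> *
     (\<Sum>s=2..<r. real (r choose s) * (real n ^ (r - s) * p ^ ((r choose 2) - (s choose 2)))))"
    using sums(2) unfolding \<mu>_def by (intro mult_left_mono) auto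
  also have "\<dots> = (\<Sum>s=2..<r. real (r choose s) * (x\<^sup>2 * \<mu> * (real n ^ (r - s) * p ^ ((r choose 2) - (s choose 2)))))"
    by (simp add: sum_distrib_left mult_ac)
  also have "\<dots> \<le> (\<Sum>s=2..<r. real (r choose s) * (4 * real r ^ Suc r * sqrt (real n)))"
    by (intro sum_mono mult_left_mono D) auto
  also have "\<dots> = 4 * real r ^ Suc r * (\<Sum>s=2..<r. real (r choose s)) * sqrt (real n)"
    by (simp add: sum_distrib_right sum_distrib_left mult_ac)
  finally have pairs: "x\<^sup>2 * residual_pairs p P I \<le> 4 * real r ^ Suc r * (\<Sum>s=2..<r. real (r choose s)) * sqrt (real n)" .
  have loss: "x * (real (k * (r choose 2) * n ^ (r - 2)) * ?q) \<le> 2 * ?K * real r ^ r * sqrt (real n)"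
  proof -
    have "r - 2 + 2 = r" using n(2) by simp
    hence nn: "real n ^ (r - 2) * (real n)\<^sup>2 = real n ^ r" by (simp only: power_add[symmetric])
    have "x * (real (k * (r choose 2) * n ^ (r - 2)) * ?q) * (real n)\<^sup>2 =
       x * (real k * ?K * ((real n ^ (r - 2) * (real n)\<^sup>2) * ?q))" by simp
    also have "\<dots> \<le> x * (real k * ?K * (real r ^ r * \<mu>))"
      unfolding nn using x0 by (intro mult_left_mono nq) auto
    also have "\<dots> = real k * ?K * real r ^ r * (x * \<mu>)" by simp
    also have "\<dots> \<le> real k * ?K * real r ^ r * (2 * real k)" by (intro mult_left_mono x\<mu>) auto
    also have "\<dots> = (2 * ?K * real r ^ r) * (real k)\<^sup>2" by (simp add: power2_eq_square)
    also have "\<dots> \<le> (2 * ?K * real r ^ r) * (real n)\<^sup>2" using kn by (intro mult_left_mono power_mono) auto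
    finally have "x * (real (k * (r choose 2) * n ^ (r - 2)) * ?q) \<le> 2 * ?K * real r ^ r * 1"
      using n0 by (simp only: mult_le_cancel_right_pos zero_less_power of_nat_0_less_iff mult_1_right)
    also have "\<dots> \<le> 2 * ?K * real r ^ r * sqrt (real n)" using sn by (intro mult_left_mono) auto
    finally show ?thesis .
  qed
  have "x * (\<mu> - real (k * (r choose 2) * n ^ (r - 2)) * ?q) \<le> x * (\<Sum>S\<in>I. p ^ card (residual P S))"
    using sums(1) x0 unfolding \<mu>_def by (intro mult_left_mono) auto
  with pairs loss show ?thesis unfolding \<mu>_def by (simp add: algebra_simps)
qed

text \<open>For triangles the pairs sharing an edge cost about $x^2 \cdot 3 n \mu p^2 \approx x n^2 p^2$ with
  $x = k/m$, which is more than $\sqrt n$ but is compensated by the roughly $n^2 p^2$ expected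
  triangles that use exactly one edge of the factor.\<close>

lemma triangle_family_exponent:
  assumes n: "n = 3 * k" "k > 0" and p: "0 \<le> p" "p \<le> 1" "real n * p\<^sup>2 \<le> 1"
    and m: "m = nat \<lfloor>real (n choose 3) * p ^ 3\<rfloor>" "3 * k \<le> m"
    and P: "P \<in> factors {..<n} 3"
  defines "x \<equiv> real k / real m" and "I \<equiv> k_sets n 3 - P"
  shows "- x * (\<Sum>S\<in>I. p ^ card (residual P S)) + x\<^sup>2 * residual_pairs p P I \<le>
    - x * (real (n choose 3) * p ^ 3) + 184 * sqrt (real n)"
proof -
  define \<mu> where "\<mu> = real (n choose 3) * p ^ 3"
  define w where "w = real n"
  have w: "w \<ge> 1" "real k \<le> w" "w = 3 * real k" using n by (auto simp: w_def)
  have m0: "m > 0" using m(2) n(2) by auto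
  have p3: "0 \<le> p ^ 3" using p by simp
  have \<mu>0: "0 \<le> \<mu>" using p3 by (simp add: \<mu>_def)
  have \<mu>m: "\<mu> \<le> real m + 1" "\<mu> \<le> 2 * real m"
    using m(1) \<mu>0 m0 unfolding \<mu>_def[symmetric] by linarith+
  have "3 * real k \<le> real m" using m(2) by linarith
  hence x: "0 \<le> x" "x \<le> 1 / 3" using m0 by (simp_all add: x_def pos_divide_le_eq)
  \<comment> \<open>The term x n^2 p^2 has to cancel with its exact coefficient, which calls for
    this additive form. The cruder \<open>x\<mu>2\<close> serves the other error terms.\<close>
  have x\<mu>: "x * \<mu> \<le> real k + x"
    using mult_left_mono[OF \<mu>m(1) x(1)] m0 by (simp add: x_def field_simps)
  have x\<mu>2: "x * \<mu> \<le> 2 * real k"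
    using mult_left_mono[OF \<mu>m(2) x(1)] m0 by (simp add: x_def)
  have sn: "1 \<le> sqrt w" using w by simp
  have key: "x * (w\<^sup>2 * p ^ 3) \<le> 18"
  proof -
    have "w ^ 3 * p ^ 3 \<le> 27 * \<mu>"
      using mult_right_mono[OF binomial_lower[of 3 k] p3] n by (simp add: w_def \<mu>_def mult_ac)
    hence "x * (w ^ 3 * p ^ 3) \<le> x * (27 * \<mu>)" using x by (intro mult_left_mono)
    also have "x * (27 * \<mu>) = 27 * (x * \<mu>)" by (simp only: mult.left_commute)
    also have "\<dots> \<le> 54 * real k" using x\<mu>2 by linarith
    also have "\<dots> = 18 * w" using w by simp
    finally have "x * (w\<^sup>2 * p ^ 3) * w \<le> 18 * w" by (simp add: power2_eq_square power3_eq_cube mult_ac)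
    thus ?thesis using w by simp
  qed
  have wp: "w * p \<le> sqrt w"
  proof (rule real_le_rsqrt)
    have "w * (w * p\<^sup>2) \<le> w * 1" using p(3) w by (intro mult_left_mono) (auto simp: w_def)
    thus "(w * p)\<^sup>2 \<le> w" by (simp add: power2_eq_square mult_ac)
  qed
  have wp2: "0 \<le> w * p\<^sup>2" "w * p\<^sup>2 \<le> 1" using p w by (auto simp: w_def)
  note sums = triangle_family_sums[OF P n p(1,2), folded I_def w_def]
  have s1: "x * (\<mu> - real k * p ^ 3 + w * (w - 3) * (p\<^sup>2 - p ^ 3)) \<le> x * (\<Sum>S\<in>I. p ^ card (residual P S))"
    using sums(1) x unfolding \<mu>_def by (intro mult_left_mono) auto
  have s2: "x\<^sup>2 * residual_pairs p P I \<le> x\<^sup>2 * (3 * w * real (n choose 3) * p ^ 5 + 6 * w ^ 3 * p ^ 4 + 18 * w\<^sup>2 * p ^ 3)"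
    using sums(2) by (intro mult_left_mono) auto
  \<comment> \<open>As 3 k = n, the leading part 3 n p^2 x k is x n^2 p^2, the same term that
    \<open>s1\<close> gains from triangles with a planted edge.\<close>
  have cancel: "x\<^sup>2 * (3 * w * real (n choose 3) * p ^ 5) \<le> x * (w\<^sup>2 * p\<^sup>2) + 1"
  proof -
    have "p ^ 5 = p ^ 3 * p\<^sup>2" by (simp add: power_add[symmetric])
    hence "x\<^sup>2 * (3 * w * real (n choose 3) * p ^ 5) = x * (3 * (w * p\<^sup>2)) * (x * \<mu>)"
      by (simp add: \<mu>_def power2_eq_square mult_ac)
    also have "\<dots> \<le> x * (3 * (w * p\<^sup>2)) * (real k + x)"
      using x wp2 by (intro mult_left_mono x\<mu>) auto
    also have "\<dots> = x * (w\<^sup>2 * p\<^sup>2) + 3 * (x * x) * (w * p\<^sup>2)"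
      unfolding w(3) by (simp add: power2_eq_square algebra_simps)
    also have "3 * (x * x) * (w * p\<^sup>2) \<le> 3 * ((1 / 3) * (1 / 3)) * 1"
      using x wp2 w by (intro mult_mono mult_nonneg_nonneg) auto
    finally show ?thesis by simp
  qed
  have t1: "x\<^sup>2 * (6 * w ^ 3 * p ^ 4) \<le> 36 * sqrt w"
  proof -
    have "p ^ 4 = p ^ 3 * p" by (simp add: power_add[symmetric] power_eq_if)
    hence "x\<^sup>2 * (6 * w ^ 3 * p ^ 4) = 6 * x * (x * (w\<^sup>2 * p ^ 3)) * (w * p)"
      by (simp add: power2_eq_square power3_eq_cube mult_ac)
    also have "\<dots> \<le> 6 * (1 / 3) * 18 * sqrt w"
      using x wp key p w by (intro mult_mono mult_nonneg_nonneg) auto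
    finally show ?thesis by simp
  qed
  have t2: "x\<^sup>2 * (18 * w\<^sup>2 * p ^ 3) \<le> 108"
  proof -
    have "x\<^sup>2 * (18 * w\<^sup>2 * p ^ 3) = 18 * x * (x * (w\<^sup>2 * p ^ 3))" by (simp add: power2_eq_square mult_ac)
    also have "\<dots> \<le> 18 * (1 / 3) * 18"
      using x key p by (intro mult_mono mult_nonneg_nonneg) auto
    finally show ?thesis by simp
  qed
  have t3: "x * (real k * p ^ 3) \<le> 18"
  proof -
    have "real k \<le> w\<^sup>2" using w mult_mono[of 1 w "real k" w] by (simp add: power2_eq_square)
    hence "x * (real k * p ^ 3) \<le> x * (w\<^sup>2 * p ^ 3)" using x p3 by (intro mult_left_mono mult_right_mono) auto
    thus ?thesis using key by simp
  qed
  have t4: "x * (3 * (w * p\<^sup>2)) \<le> 1"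
    using mult_mono[of x "1/3" "3 * (w * p\<^sup>2)" 3] x wp2 by simp
  have t5: "0 \<le> x * (w * p ^ 3)" using x w p3 by simp
  have expand: "x * (\<mu> - real k * p ^ 3 + w * (w - 3) * (p\<^sup>2 - p ^ 3)) =
     x * \<mu> - x * (real k * p ^ 3) + x * (w\<^sup>2 * p\<^sup>2) - x * (w\<^sup>2 * p ^ 3) - x * (3 * (w * p\<^sup>2)) + 3 * (x * (w * p ^ 3))"
    by (simp add: algebra_simps power2_eq_square)
  have expand2: "x\<^sup>2 * (3 * w * real (n choose 3) * p ^ 5 + 6 * w ^ 3 * p ^ 4 + 18 * w\<^sup>2 * p ^ 3) =
     x\<^sup>2 * (3 * w * real (n choose 3) * p ^ 5) + x\<^sup>2 * (6 * w ^ 3 * p ^ 4) + x\<^sup>2 * (18 * w\<^sup>2 * p ^ 3)"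
    by (simp only: distrib_left)
  \<comment> \<open>The errors are 1 from \<open>cancel\<close>, 36 sqrt n from \<open>t1\<close>,
    and 108, 18, 1 and 18 from \<open>t2\<close>, \<open>t3\<close>, \<open>t4\<close> and
    \<open>key\<close>; together they stay within 184 sqrt n.\<close>
  have "- (x * (\<Sum>S\<in>I. p ^ card (residual P S))) + x\<^sup>2 * residual_pairs p P I \<le> - (x * \<mu>) + 184 * sqrt w"
    using s1 s2 cancel t1 t2 t3 t4 t5 key sn unfolding expand expand2 by linarith
  thus ?thesis unfolding \<mu>_def w_def by simp
qed

text \<open>Hides the choice of the family behind a constant that depends on r alone, so that the
  upper tail can be treated uniformly in r.\<close>

lemma planted_family_exists:
  assumes r: "r \<ge> 3"
  obtains c where "0 \<le> c"
    "\<And>n k p m P. \<lbrakk>n = r * k; k > 0; 0 \<le> p; p \<le> 1;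
        p \<le> real n powr (- 2 / real r + (real r - 2) / (real r * real (r choose 2)));
        m = nat \<lfloor>real (n choose r) * p ^ (r choose 2)\<rfloor>; 3 * k \<le> m; P \<in> factors {..<n} r\<rbrakk> \<Longrightarrow>
      \<exists>I. I \<subseteq> k_sets n r - P \<and>
        - (real k / real m) * (\<Sum>S\<in>I. p ^ card (residual P S)) + (real k / real m)\<^sup>2 * residual_pairs p P I \<le>
        - (real k / real m) * (real (n choose r) * p ^ (r choose 2)) + c * sqrt (real n)"
proof (cases "r = 3")
  case True
  show ?thesis
  proof (rule that[of 184])
    fix n k m :: nat and p :: real and P
    assume h: "n = r * k" "k > 0" "0 \<le> p" "p \<le> 1"
        "p \<le> real n powr (- 2 / real r + (real r - 2) / (real r * real (r choose 2)))"
        "m = nat \<lfloor>real (n choose r) * p ^ (r choose 2)\<rfloor>" "3 * k \<le> m" "P \<in> factors {..<n} r"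
    have c2: "(3 choose 2) = (3::nat)" "(2 choose 2) = (1::nat)" by (simp_all add: numeral_3_eq_3 numeral_2_eq_2)
    have "real n ^ (r - 2) * p ^ ((r choose 2) - (2 choose 2)) \<le> 1"
      using h r by (intro overlap_density_le_1) auto
    hence d: "real n * p\<^sup>2 \<le> 1" using True by (simp add: c2)
    have h': "n = 3 * k" "m = nat \<lfloor>real (n choose 3) * p ^ 3\<rfloor>" "P \<in> factors {..<n} 3"
      using h True by (simp_all add: c2)
    show "\<exists>I. I \<subseteq> k_sets n r - P \<and>
        - (real k / real m) * (\<Sum>S\<in>I. p ^ card (residual P S)) + (real k / real m)\<^sup>2 * residual_pairs p P I \<le>
        - (real k / real m) * (real (n choose r) * p ^ (r choose 2)) + 184 * sqrt (real n)"
      unfolding True c2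
      by (rule exI[of _ "k_sets n 3 - P"], rule conjI, rule order.refl,
          rule triangle_family_exponent[OF h'(1) h(2,3,4) d h'(2) h(7) h'(3)])
  qed simp
next
  case False
  hence r4: "r \<ge> 4" using r by simp
  show ?thesis
  proof (rule that[of "2 * real (r choose 2) * real r ^ r + 4 * real r ^ Suc r * (\<Sum>s=2..<r. real (r choose s))"])
    fix n k m :: nat and p :: real and P
    assume h: "n = r * k" "k > 0" "0 \<le> p" "p \<le> 1"
        "m = nat \<lfloor>real (n choose r) * p ^ (r choose 2)\<rfloor>" "3 * k \<le> m" "P \<in> factors {..<n} r"
    have "S \<notin> P" if "S \<in> k_sets n r" "all_edges S \<inter> edges_of P = {}" for S
    proof
      assume "S \<in> P"
      hence "all_edges S = {}" using that by (auto simp: edges_of_def)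
      hence "r choose 2 = 0" using card_all_edges_k_sets[OF that(1)] by simp
      thus False using r by simp
    qed
    hence "{S \<in> k_sets n r. all_edges S \<inter> edges_of P = {}} \<subseteq> k_sets n r - P" by auto
    thus "\<exists>I. I \<subseteq> k_sets n r - P \<and>
        - (real k / real m) * (\<Sum>S\<in>I. p ^ card (residual P S)) + (real k / real m)\<^sup>2 * residual_pairs p P I \<le>
        - (real k / real m) * (real (n choose r) * p ^ (r choose 2)) +
          (2 * real (r choose 2) * real r ^ r + 4 * real r ^ Suc r * (\<Sum>s=2..<r. real (r choose s))) * sqrt (real n)"
      using disjoint_family_exponent[OF h(1) r4 h(2-7)] by blast
  qed (intro add_nonneg_nonneg mult_nonneg_nonneg sum_nonneg, auto)
qed

text \<open>By \<open>overlap_density_le_1\<close> the expected number of extensions in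
  \<open>sum_meeting_le\<close> is bounded for each s, so the variance is O(\<mu>). The factor ln n
  in the deviation turns this into the failure probability O(1 / (ln n)^2).\<close>

lemma clique_count_concentration:
  fixes p :: real
  assumes r: "r \<ge> 3" and n: "n > 1" and p: "0 \<le> p" "p \<le> 1"
      "p \<le> real n powr (- 2 / real r + (real r - 2) / (real r * real (r choose 2)))"
    and \<mu>: "0 < real (n choose r) * p ^ (r choose 2)" (is "0 < ?\<mu>")
  shows "measure_pmf.prob (random_subset (all_edges {..<n}) p)
      {R. ?\<mu> + sqrt ?\<mu> * ln (real n) \<le> real (card {S\<in>k_sets n r. all_edges S \<subseteq> R})} \<le>
    (1 + (\<Sum>s=2..<r. real (r choose s))) / (ln (real n))\<^sup>2"
proof -
  let ?C = "\<Sum>s=2..<r. real (r choose s)" and ?q = "p ^ (r choose 2)"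
  let ?t = "sqrt ?\<mu> * ln (real n)"
  have L: "0 < ln (real n)" using n by simp
  have t: "0 < ?t" using \<mu> L by simp
  have sum1: "(\<Sum>S\<in>k_sets n r. p ^ card (all_edges S)) = ?\<mu>"
    by (simp add: card_all_edges_k_sets card_k_sets)
  have "(\<Sum>S\<in>k_sets n r. \<Sum>T\<in>{T\<in>k_sets n r. T \<noteq> S \<and> all_edges S \<inter> all_edges T \<noteq> {}}.
      p ^ card (all_edges S \<union> all_edges T)) \<le> (\<Sum>S\<in>k_sets n r. ?q * ?C)"
  proof (rule sum_mono)
    fix S assume S: "S \<in> k_sets n r"
    have "(\<Sum>T\<in>meeting n r S. p ^ card (all_edges S \<union> all_edges T)) \<le> ?q *
      (\<Sum>s=2..<r. real (r choose s) * (real n ^ (r - s) * p ^ ((r choose 2) - (s choose 2))))"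
      by (rule sum_meeting_le[OF S p(1)])
    also have "\<dots> \<le> ?q * (\<Sum>s=2..<r. real (r choose s) * 1)"
      using p n by (intro mult_left_mono sum_mono overlap_density_le_1 r) auto
    finally show "(\<Sum>T\<in>{T\<in>k_sets n r. T \<noteq> S \<and> all_edges S \<inter> all_edges T \<noteq> {}}.
      p ^ card (all_edges S \<union> all_edges T)) \<le> ?q * ?C" by (simp add: meeting_def)
  qed
  also have "\<dots> = ?\<mu> * ?C" by (simp add: card_k_sets)
  finally have sum2: "(\<Sum>S\<in>k_sets n r. \<Sum>T\<in>{T\<in>k_sets n r. T \<noteq> S \<and> all_edges S \<inter> all_edges T \<noteq> {}}.
      p ^ card (all_edges S \<union> all_edges T)) \<le> ?\<mu> * ?C" .
  have "measure_pmf.prob (random_subset (all_edges {..<n}) p)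
      {R. ?\<mu> + ?t \<le> real (card {S\<in>k_sets n r. all_edges S \<subseteq> R})} \<le>
     (?\<mu> + (\<Sum>S\<in>k_sets n r. \<Sum>T\<in>{T\<in>k_sets n r. T \<noteq> S \<and> all_edges S \<inter> all_edges T \<noteq> {}}.
      p ^ card (all_edges S \<union> all_edges T))) / ?t\<^sup>2"
    unfolding sum1[symmetric]
    by (rule Chebyshev_superset_count) (use p t sum1 in \<open>auto simp: k_sets_def intro!: all_edges_mono\<close>)
  also have "\<dots> \<le> (?\<mu> + ?\<mu> * ?C) / ?t\<^sup>2" using sum2 by (intro divide_right_mono add_left_mono) auto
  also have "\<dots> = (?\<mu> * (1 + ?C)) / (?\<mu> * (ln (real n))\<^sup>2)" using \<mu> by (simp add: power_mult_distrib distrib_left)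
  also have "\<dots> = (1 + ?C) / (ln (real n))\<^sup>2" using \<mu> by (rule mult_divide_mult_cancel_left[OF less_imp_neq[THEN not_sym]])
  finally show ?thesis .
qed

section \<open>The upper tail of the number of factors\<close>

text \<open>Explicit in n and uniform in p, so that only a limit remains for the theorem. The error
  terms belong to the first moment in the case m < 3k, to Markov's inequality for the truncated
  count, and to the concentration of the number of copies.\<close>

lemma clique_factor_upper_tail:
  assumes r: "r \<ge> 3"
  obtains c where "0 \<le> c"
    "\<And>n k p. \<lbrakk>n = r * k; n \<ge> 3; 0 \<le> p; p \<le> 1;
        p \<le> real n powr (- 2 / real r + (real r - 2) / (real r * real (r choose 2)))\<rbrakk> \<Longrightarrow>
      1 - ((exp 1)\<^sup>2 * (3 / 4) ^ k + 1 / real n + c / (ln (real n))\<^sup>2) \<le>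
      measure_pmf.prob (Gnp n p) {E. real (num_clique_factors r {..<n} E) \<le>
        exp (c * sqrt (real n) * ln (real n)) *
        Sigma_factors r n (nat \<lfloor>real (n choose r) * p ^ (r choose 2)\<rfloor>)}"
proof -
  obtain c0 where c0: "0 \<le> c0" and fam:
    "\<And>n k p m P. \<lbrakk>n = r * k; k > 0; 0 \<le> p; p \<le> 1;
        p \<le> real n powr (- 2 / real r + (real r - 2) / (real r * real (r choose 2)));
        m = nat \<lfloor>real (n choose r) * p ^ (r choose 2)\<rfloor>; 3 * k \<le> m; P \<in> factors {..<n} r\<rbrakk> \<Longrightarrow>
      \<exists>I. I \<subseteq> k_sets n r - P \<and>
        - (real k / real m) * (\<Sum>S\<in>I. p ^ card (residual P S)) + (real k / real m)\<^sup>2 * residual_pairs p P I \<le>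
        - (real k / real m) * (real (n choose r) * p ^ (r choose 2)) + c0 * sqrt (real n)"
    using planted_family_exists[OF r] by metis
  define C where "C = 1 + (\<Sum>s=2..<r. real (r choose s))"
  have C0: "0 \<le> C" unfolding C_def by (intro add_nonneg_nonneg sum_nonneg) auto
  \<comment> \<open>One constant serves both the exponent, which needs c0 + 5, and the concentration
    bound, which needs C.\<close>
  define c where "c = c0 + 5 + C"
  show ?thesis
  proof (rule that[of c])
    show "0 \<le> c" using c0 C0 by (simp add: c_def)
    fix n k :: nat and p :: real
    assume n: "n = r * k" "n \<ge> 3" and p: "0 \<le> p" "p \<le> 1"
        "p \<le> real n powr (- 2 / real r + (real r - 2) / (real r * real (r choose 2)))"
    let ?E = "all_edges {..<n}" and ?q = "p ^ (r choose 2)"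
    let ?\<mu> = "real (n choose r) * ?q"
    define m where "m = nat \<lfloor>?\<mu>\<rfloor>"
    define F where "F = (\<lambda>R. real (num_clique_factors r {..<n} R))"
    define U where "U = exp (c * sqrt (real n) * ln (real n)) * Sigma_factors r n m"
    have r0: "r > 0" using r by simp
    have k: "k > 0" using n by (cases "k = 0") auto
    have q0: "0 \<le> ?q" using p by simp
    have L: "0 < ln (real n)" using n(2) by simp
    have U0: "0 \<le> U" unfolding U_def using Sigma_factors_nonneg[OF r0 n(1)] by simp
    have F0: "0 \<le> F R" for R by (simp add: F_def)
    have bad: "measure_pmf.prob (random_subset ?E p) {R. \<not> F R \<le> U} \<le>
        (exp 1)\<^sup>2 * (3 / 4) ^ k + 1 / real n + c / (ln (real n))\<^sup>2"
    proof (cases "3 * k \<le> m")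
      case False
      hence "?\<mu> \<le> 3 * real k" unfolding m_def by linarith
      hence mom: "rs_exp ?E p F \<le> (exp 1)\<^sup>2 * (3 / 4) ^ k"
        unfolding F_def factor_moment[OF n(1) r0 p(1,2)] by (intro sparse_factor_moment n k r q0)
      \<comment> \<open>In this case m may be smaller than k, and then U = 0. The number of factors
        is an integer, so exceeding U \<ge> 0 means being at least 1.\<close>
      have "{R. \<not> F R \<le> U} \<subseteq> {R. 1 \<le> F R}"
      proof clarify
        fix R assume "\<not> F R \<le> U"
        hence "F R > 0" using U0 by linarith
        thus "1 \<le> F R" by (simp add: F_def)
      qed
      hence "measure_pmf.prob (random_subset ?E p) {R. \<not> F R \<le> U} \<le> measure_pmf.prob (random_subset ?E p) {R. 1 \<le> F R}"
        by (intro measure_pmf.finite_measure_mono) auto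
      also have "\<dots> \<le> rs_exp ?E p F / 1" by (intro Markov_random_subset F0) auto
      finally have "measure_pmf.prob (random_subset ?E p) {R. \<not> F R \<le> U} \<le> (exp 1)\<^sup>2 * (3 / 4) ^ k"
        using mom by simp
      moreover have "0 \<le> 1 / real n" "0 \<le> c / (ln (real n))\<^sup>2" using c0 C0 by (auto simp: c_def)
      ultimately show ?thesis by linarith
    next
      case True
      have m0: "m > 0" "k < m" using True k by auto
      have \<mu>m: "real m \<le> ?\<mu>" "?\<mu> < real m + 1"
        using m0 unfolding m_def by linarith+
      have \<mu>0: "0 < ?\<mu>" using \<mu>m m0 by linarith
      define x where "x = real k / real m"
      have x: "0 \<le> x" "x < 1" using m0 by (auto simp: x_def)
      define t where "t = nat \<lceil>sqrt ?\<mu> * ln (real n)\<rceil>"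
      have t: "sqrt ?\<mu> * ln (real n) \<le> real t" "real t \<le> sqrt ?\<mu> * ln (real n) + 1"
      proof -
        have "0 \<le> sqrt ?\<mu> * ln (real n)" using L \<mu>0 by (intro mult_nonneg_nonneg) auto
        thus "sqrt ?\<mu> * ln (real n) \<le> real t" "real t \<le> sqrt ?\<mu> * ln (real n) + 1"
          unfolding t_def by linarith+
      qed
      define X where "X = (\<lambda>R. card {S\<in>k_sets n r. all_edges S \<subseteq> R})"
      define B where "B = - x * ?\<mu> + c0 * sqrt (real n)"
      have "\<forall>P\<in>factors {..<n} r. \<exists>I. I \<subseteq> k_sets n r - P \<and>
        - x * (\<Sum>S\<in>I. p ^ card (residual P S)) + x\<^sup>2 * residual_pairs p P I \<le> B"
        unfolding x_def B_def using fam[OF n(1) k p m_def True] by blast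
      then obtain I where I: "\<And>P. P \<in> factors {..<n} r \<Longrightarrow> I P \<subseteq> k_sets n r - P"
        "\<And>P. P \<in> factors {..<n} r \<Longrightarrow>
          - x * (\<Sum>S\<in>I P. p ^ card (residual P S)) + x\<^sup>2 * residual_pairs p P (I P) \<le> B"
        by metis
      have "real n * rs_exp ?E p (\<lambda>R. F R * of_bool (X R \<le> m + t)) \<le>
          real n * (real (card (factors {..<n} r)) * ?q ^ k * exp B / (1 - x) ^ (m + t - k))"
        unfolding F_def X_def using m0
        by (intro mult_left_mono truncated_factor_moment[where I = I] n r0 p x I) auto
      also have "\<dots> \<le> exp ((c0 + 5) * sqrt (real n) * ln (real n)) * Sigma_factors r n m"
        unfolding x_def
        by (rule Sigma_comparison[OF n(1) r n(2) q0 m_def True t(2) _ c0]) (simp add: B_def x_def)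
      also have "\<dots> \<le> U"
      proof -
        have "(c0 + 5) * sqrt (real n) * ln (real n) \<le> c * sqrt (real n) * ln (real n)"
          using L C0 by (intro mult_right_mono) (auto simp: c_def)
        thus ?thesis unfolding U_def using Sigma_factors_nonneg[OF r0 n(1)] by (intro mult_right_mono) auto
      qed
      finally have mom: "real n * rs_exp ?E p (\<lambda>R. F R * of_bool (X R \<le> m + t)) \<le> U" .
      \<comment> \<open>Markov's inequality is applied at level U, and k < m makes the falling
        factorials positive.\<close>
      have Upos: "0 < U"
        unfolding U_def Sigma_factors_def
        using falling_fact_pos[of k m] falling_fact_pos[OF le_binomial[OF r0]] m0 n(1) r0 by simp
      have "{R. \<not> F R \<le> U} \<subseteq> {R. U \<le> F R * of_bool (X R \<le> m + t)} \<union>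
          {R. ?\<mu> + sqrt ?\<mu> * ln (real n) \<le> real (X R)}"
      proof (rule subsetI)
        fix R assume R: "R \<in> {R. \<not> F R \<le> U}"
        show "R \<in> {R. U \<le> F R * of_bool (X R \<le> m + t)} \<union>
          {R. ?\<mu> + sqrt ?\<mu> * ln (real n) \<le> real (X R)}"
        proof (cases "X R \<le> m + t")
          case True
          thus ?thesis using R by auto
        next
          case False
          \<comment> \<open>Integrality gains the 1 that rounding \<mu> down had lost, since \<mu> <
            m + 1.\<close>
          hence "real m + real t + 1 \<le> real (X R)" by linarith
          hence "?\<mu> + sqrt ?\<mu> * ln (real n) \<le> real (X R)" using \<mu>m t by linarith
          thus ?thesis by simp
        qed
      qed
      hence "measure_pmf.prob (random_subset ?E p) {R. \<not> F R \<le> U} \<le>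
         measure_pmf.prob (random_subset ?E p) ({R. U \<le> F R * of_bool (X R \<le> m + t)} \<union>
          {R. ?\<mu> + sqrt ?\<mu> * ln (real n) \<le> real (X R)})"
        by (intro measure_pmf.finite_measure_mono) auto
      also have "\<dots> \<le> measure_pmf.prob (random_subset ?E p) {R. U \<le> F R * of_bool (X R \<le> m + t)} +
         measure_pmf.prob (random_subset ?E p) {R. ?\<mu> + sqrt ?\<mu> * ln (real n) \<le> real (X R)}"
        by (rule measure_Un_le) auto
      also have "\<dots> \<le> 1 / real n + C / (ln (real n))\<^sup>2"
      proof (rule add_mono)
        have "measure_pmf.prob (random_subset ?E p) {R. U \<le> F R * of_bool (X R \<le> m + t)} \<le>
            rs_exp ?E p (\<lambda>R. F R * of_bool (X R \<le> m + t)) / U"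
          using F0 by (intro Markov_random_subset Upos) auto
        also have "\<dots> \<le> 1 / real n" using mom Upos n(2) by (simp add: field_simps)
        finally show "measure_pmf.prob (random_subset ?E p) {R. U \<le> F R * of_bool (X R \<le> m + t)} \<le> 1 / real n" .
        show "measure_pmf.prob (random_subset ?E p) {R. ?\<mu> + sqrt ?\<mu> * ln (real n) \<le> real (X R)} \<le> C / (ln (real n))\<^sup>2"
          unfolding X_def C_def using n(2) by (intro clique_count_concentration r p \<mu>0) auto
      qed
      also have "\<dots> \<le> 1 / real n + c / (ln (real n))\<^sup>2"
        using c0 by (intro add_left_mono divide_right_mono) (auto simp: c_def)
      also have "\<dots> \<le> (exp 1)\<^sup>2 * (3 / 4) ^ k + 1 / real n + c / (ln (real n))\<^sup>2" by simp
      finally show ?thesis .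
    qed
    have "measure_pmf.prob (random_subset ?E p) {R. F R \<le> U} =
        1 - measure_pmf.prob (random_subset ?E p) {R. \<not> F R \<le> U}"
      using measure_pmf.prob_compl[of "{R. \<not> F R \<le> U}" "random_subset ?E p"]
      by (simp add: Collect_neg_eq[symmetric] Compl_eq_Diff_UNIV[symmetric])
    with bad show "1 - ((exp 1)\<^sup>2 * (3 / 4) ^ k + 1 / real n + c / (ln (real n))\<^sup>2) \<le>
      measure_pmf.prob (Gnp n p) {E. real (num_clique_factors r {..<n} E) \<le>
        exp (c * sqrt (real n) * ln (real n)) *
        Sigma_factors r n (nat \<lfloor>real (n choose r) * p ^ (r choose 2)\<rfloor>)}"
      unfolding Gnp_eq_random_subset F_def U_def m_def by linarith
  qed
qed

theorem theorem7p4: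
  fixes r :: nat
  assumes "r \<ge> 3"
  shows "\<exists>\<gamma>>0. \<forall>\<epsilon>::real. \<epsilon> > 0 \<longrightarrow>
    (\<forall>p :: nat \<Rightarrow> real.
      (\<forall>n. n > 0 \<and> r dvd n \<longrightarrow>
         0 \<le> p n \<and> p n \<le> 1 \<and> p n \<le> real n powr (- 2 / real r + \<gamma>)) \<longrightarrow>
      (\<exists>f. bigo_star f (\<lambda>n. sqrt (real n)) \<and>
         whp r (\<lambda>n. Gnp n (p n))
           (\<lambda>n E. real (num_clique_factors r {..<n} E) \<le>
              exp (f n) *
              Sigma_factors r n (nat \<lfloor>real (n choose r) * p n ^ (r choose 2)\<rfloor>))))"
proof -
  define \<gamma> where "\<gamma> = (real r - 2) / (real r * real (r choose 2))"
  obtain c where c: "0 \<le> c" and tail: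
    "\<And>n k p. \<lbrakk>n = r * k; n \<ge> 3; 0 \<le> p; p \<le> 1; p \<le> real n powr (- 2 / real r + \<gamma>)\<rbrakk> \<Longrightarrow>
      1 - ((exp 1)\<^sup>2 * (3 / 4) ^ k + 1 / real n + c / (ln (real n))\<^sup>2) \<le>
      measure_pmf.prob (Gnp n p) {E. real (num_clique_factors r {..<n} E) \<le>
        exp (c * sqrt (real n) * ln (real n)) *
        Sigma_factors r n (nat \<lfloor>real (n choose r) * p ^ (r choose 2)\<rfloor>)}"
    using clique_factor_upper_tail[OF assms] unfolding \<gamma>_def by metis
  define f where "f = (\<lambda>n. c * sqrt (real n) * ln (real n))"
  have "f \<in> O(\<lambda>n. sqrt (real n) * ln (real n) powr 1)"
  proof (rule bigoI[of _ c], rule always_eventually, rule allI)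
    fix n :: nat
    \<comment> \<open>At n = 0 the convention ln 0 = 0 applies.\<close>
    have "0 \<le> ln (real n)" by (cases "n = 0") auto
    thus "norm (f n) \<le> c * norm (sqrt (real n) * ln (real n) powr 1)"
      using c by (simp add: f_def abs_mult)
  qed
  hence f: "bigo_star f (\<lambda>n. sqrt (real n))" unfolding bigo_star_def by blast
  have "whp r (\<lambda>n. Gnp n (p n)) (\<lambda>n E. real (num_clique_factors r {..<n} E) \<le>
      exp (f n) * Sigma_factors r n (nat \<lfloor>real (n choose r) * p n ^ (r choose 2)\<rfloor>))"
    if p: "\<forall>n. n > 0 \<and> r dvd n \<longrightarrow> 0 \<le> p n \<and> p n \<le> 1 \<and> p n \<le> real n powr (- 2 / real r + \<gamma>)"
    for p :: "nat \<Rightarrow> real"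
    unfolding whp_def
  proof (rule tendsto_sandwich)
    let ?F = "inf sequentially (principal {n. r dvd n})"
    \<comment> \<open>Writing n/r for k makes g a function on all naturals. Its limit is taken along
      the full sequence and then restricted to the multiples of r.\<close>
    define g where "g = (\<lambda>n::nat. 1 - ((exp 1)\<^sup>2 * (3 / 4) powr (real n / real r) + 1 / real n + c / (ln (real n))\<^sup>2))"
    have "(3 / 4 :: real) powr (1 / real r) < 1"
      using assms by (simp add: powr_def divide_neg_pos)
    hence "((\<lambda>n::nat. ((3 / 4 :: real) powr (1 / real r)) ^ n) \<longlongrightarrow> 0) sequentially"
      by (intro LIMSEQ_realpow_zero) auto
    hence "((\<lambda>n::nat. (3 / 4 :: real) powr (real n / real r)) \<longlongrightarrow> 0) sequentially"
      by (simp add: powr_realpow[symmetric] powr_powr)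
    moreover have "((\<lambda>n::nat. 1 / real n) \<longlongrightarrow> 0) sequentially" by real_asymp
    moreover have "((\<lambda>n::nat. c / (ln (real n))\<^sup>2) \<longlongrightarrow> 0) sequentially" by real_asymp
    ultimately have "(g \<longlongrightarrow> 1 - ((exp 1)\<^sup>2 * 0 + 0 + 0)) sequentially"
      unfolding g_def by (intro tendsto_intros)
    hence "(g \<longlongrightarrow> 1) sequentially" by simp
    thus "(g \<longlongrightarrow> 1) ?F" by (rule tendsto_mono[rotated]) simp
    show "\<forall>\<^sub>F n in ?F. g n \<le> measure_pmf.prob (Gnp n (p n)) {E. real (num_clique_factors r {..<n} E) \<le>
      exp (f n) * Sigma_factors r n (nat \<lfloor>real (n choose r) * p n ^ (r choose 2)\<rfloor>)}"
      unfolding eventually_inf_principal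
      using eventually_ge_at_top[of 3]
    proof eventually_elim
      case (elim n)
      show ?case
      proof (intro impI)
        assume "n \<in> {n. r dvd n}"
        then obtain k where k: "n = r * k" by auto
        have "(3 / 4 :: real) powr (real n / real r) = (3 / 4) ^ k"
          using k assms by (simp add: powr_realpow)
        moreover have "n > 0" using elim by linarith
        moreover have "r dvd n" using k by simp
        ultimately have "0 \<le> p n" "p n \<le> 1" "p n \<le> real n powr (- 2 / real r + \<gamma>)"
          "(3 / 4 :: real) powr (real n / real r) = (3 / 4) ^ k"
          using p by blast+
        thus "g n \<le> measure_pmf.prob (Gnp n (p n)) {E. real (num_clique_factors r {..<n} E) \<le>
            exp (f n) * Sigma_factors r n (nat \<lfloor>real (n choose r) * p n ^ (r choose 2)\<rfloor>)}"
          using tail[OF k elim] unfolding g_def f_def by simp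
      qed
    qed
  qed auto
  moreover have "\<gamma> > 0" unfolding \<gamma>_def using assms by (intro divide_pos_pos mult_pos_pos) auto
  ultimately show ?thesis using f by blast
qed

end
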